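(* Let $D$ be any shifted skew diagram. (1) For any finite sets of positive integers $X,Y$ (not both empty), the homotopy type of $\Delta(G^{\mathrm{bip}}_{X,Y}(D))$ is - a $(\mathrm{rect}(D^{\mathrm{bip}}_{X,Y})-1)$-dimensional sphere if $D^{\mathrm{bip}}_{X,Y}$ is spherical, and - contractible otherwise. (2) For any (nonempty) finite set of positive integers $X$, the homotopy type of $\Delta(G^{\mathrm{nonbip}}_{X}(D))$ is - contractible if there are any empty rectangles in the rectangular decomposition of $D^{\mathrm{nonbip}}_X$, and - otherwise an $s$-fold wedge of $(\mathrm{rect}(D^{\mathrm{nonbip}}_X)-1)$-dimensional spheres, where $s$ denotes the number of non-excess staircase cells.
   Context: **Shifted skew diagrams.** Given integers $\lambda_1>\dots>\lambda_\ell>0$ and $\mu_1>\dots>\mu_r>0$ with $0\le r\le \ell$ and $\mu_i<\lambda_i$ for $1\le i\le \ell$ (where $\mu_i:=0$ for $i>r$), the associated shifted skew diagram is $D=\{(i,j)\in\mathbb Z^2: 1\le i\le \ell,\ i+\mu_i+1\le j\le i+\lambda_i\}$. Its elements are called cells; $i$ is the row index (increasing downwards), $j$ the column index (increasing to the right). All cells satisfy $i<j$. **Restricted diagrams and graphs.** For finite sets of positive integers $X=\{x_1<\dots<x_m\}$, $Y=\{y_1<\dots<y_n\}$, $D^{\mathrm{bip}}_{X,Y}$ is the diagram with rows indexed by $X$ and columns indexed by $Y$, having a cell in position $(x_i,y_j)$ iff $(x_i,y_j)\in D$; and $D^{\mathrm{nonbip}}_X:=D^{\mathrm{bip}}_{X,X}$.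 The bipartite graph $G^{\mathrm{bip}}_{X,Y}(D)$ has vertex set the disjoint union $X\sqcup Y$ (even if $X,Y$ share integers) with an edge $\{x_i,y_j\}$ for every cell $(x_i,y_j)$ of $D^{\mathrm{bip}}_{X,Y}$. The graph $G^{\mathrm{nonbip}}_X(D)$ has vertex set $X$ with an edge $\{x_i,x_j\}$ for every cell $(x_i,x_j)$ of $D^{\mathrm{nonbip}}_X$. For a graph $G$ on vertex set $V$, $\Delta(G)$ is the simplicial complex on $V$ whose faces are the vertex subsets containing no edge of $G$. The staircase cells of $D^{\mathrm{nonbip}}_X$ are its cells in positions of the form $(x_i,x_{i+1})$. **Rectangular decomposition of $D^{\mathrm{bip}}_{X,Y}$** ($X\sqcup Y\ne\varnothing$, one of $X,Y$ possibly empty). The following is iterated, with $X=\{x_1<\dots<x_m\}$, $Y=\{y_1<\dots<y_n\}$ denoting the current row and column sets, until $X\sqcup Y$ is empty or a pedestal is found. The set of excess cells is initially empty. The top cell is the cell in position $(x_1,y_n)$, if $X,Y$ are both nonempty and that cell is present. Case 1: no top cell. Let $X'$ be the maximal initial segment of $X$ whose rows contain no cells of $D^{\mathrm{bip}}_{X,Y}$, and $Y'$ the maximal final segment of $Y$ whose columns contain no cells of $D^{\mathrm{bip}}_{X,Y}$ (then $X'\sqcup Y'\neq\varnothing$, but one of them may be empty). Call $D^{\mathrm{bip}}_{X',Y'}$ an empty rectangle of the decomposition. Replace $(X,Y)$ by $(X\setminus X',Y\setminus Y')$ and continue. Case 2: there is a top cell. Let $m'$ be maximal such that $(x_{m'},y_n)$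 is a cell, and $n'$ minimal such that $(x_1,y_{n'})$ is a cell; put $X'=\{x_1,\dots,x_{m'}\}$, $Y'=\{y_{n'},\dots,y_n\}$. - Subcase 2a: $(x_{m'},y_{n'})$ is a cell. Then call $D^{\mathrm{bip}}_{X',Y'}$ a full rectangle of the decomposition; add all cells of $D^{\mathrm{bip}}_{X\setminus X',Y'}$ and of $D^{\mathrm{bip}}_{X',Y\setminus Y'}$ to the excess cells; replace $(X,Y)$ by $(X\setminus X',Y\setminus Y')$ and continue. - Subcase 2b: $(x_{m'},y_{n'})$ is not a cell. Then call $D^{\mathrm{bip}}_{X',Y'}$ the pedestal of the decomposition; add all cells of $D^{\mathrm{bip}}_{X\setminus X',Y'}$ and of $D^{\mathrm{bip}}_{X',Y\setminus Y'}$ to the excess cells; terminate. The rectangular decomposition of $D^{\mathrm{nonbip}}_X$ is produced by the same algorithm, viewing it as $D^{\mathrm{bip}}_{X,Y}$ with $Y=X$; the only difference is that if a pedestal occurs, it is viewed as a diagram in the shifted plane, so that certain of its cells are distinguished as staircase cells. $D^{\mathrm{bip}}_{X,Y}$ is spherical if its rectangular decomposition has only full rectangles and possibly some excess cells, but no empty rectangles and no pedestal. The rectangularity $\mathrm{rect}(E)$ of $E=D^{\mathrm{bip}}_{X,Y}$ or $E=D^{\mathrm{nonbip}}_X$ is the number of full rectangles plus the number of pedestals ($0$ or $1$) in its rectangular decomposition.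
   Formalization: In (2), an empty rectangle with at least one row and one column whose positions (x,y) all satisfy y<x (wholly below the diagonal) is not counted; otherwise (2) fails, e.g. for D={(1,2)}, X={1,2}, where Δ is a 0-sphere. *)

theory Defs
  imports "HOL-Analysis.Analysis"
begin

section \<open>Shifted skew diagrams and their graphs\<close>

definition shifted_skew_diagram :: "(nat \<times> nat) set \<Rightarrow> bool" where
  "shifted_skew_diagram D \<longleftrightarrow>
     (\<exists>l r (lam :: nat \<Rightarrow> nat) (mu :: nat \<Rightarrow> nat).
        r \<le> l \<and>
        strict_antimono_on {1..l} lam \<and> (\<forall>i\<in>{1..l}. 0 < lam i) \<and>
        strict_antimono_on {1..r} mu \<and> (\<forall>i\<in>{1..r}. 0 < mu i) \<and> (\<forall>i>r. mu i = 0) \<and>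
        (\<forall>i\<in>{1..l}. mu i < lam i) \<and>
        D = {(i, j). 1 \<le> i \<and> i \<le> l \<and> i + mu i + 1 \<le> j \<and> j \<le> i + lam i})"

definition bip_diagram :: "(nat \<times> nat) set \<Rightarrow> nat set \<Rightarrow> nat set \<Rightarrow> (nat \<times> nat) set" where
  "bip_diagram D X Y = D \<inter> X \<times> Y"

abbreviation nonbip_diagram :: "(nat \<times> nat) set \<Rightarrow> nat set \<Rightarrow> (nat \<times> nat) set" where
  "nonbip_diagram D X \<equiv> bip_diagram D X X"

text \<open>A graph is a pair of a vertex set and a set of edges, each edge being the set of its ends.\<close>

type_synonym 'a graph = "'a set \<times> 'a set set"

definition bip_graph :: "(nat \<times> nat) set \<Rightarrow> nat set \<Rightarrow> nat set \<Rightarrow> (nat + nat) graph" where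
  "bip_graph D X Y = (X <+> Y, {{Inl x, Inr y} | x y. (x, y) \<in> bip_diagram D X Y})"

definition nonbip_graph :: "(nat \<times> nat) set \<Rightarrow> nat set \<Rightarrow> nat graph" where
  "nonbip_graph D X = (X, {{x, x'} | x x'. (x, x') \<in> nonbip_diagram D X})"

definition staircase_cells :: "(nat \<times> nat) set \<Rightarrow> nat set \<Rightarrow> (nat \<times> nat) set" where
  "staircase_cells D X = {(x, x') \<in> nonbip_diagram D X. x < x' \<and> {x<..<x'} \<inter> X = {}}"


section \<open>The complex of a graph, geometric realizations, wedges of spheres\<close>

definition indep_complex :: "'a graph \<Rightarrow> 'a set set" where
  "indep_complex G = {F. F \<subseteq> fst G \<and> (\<forall>e\<in>snd G. \<not> e \<subseteq> F)}"

text \<open>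
  Points are given by barycentric coordinates, indexed by all elements of the type and
  supported on a face. The topology is the usual one for finite complexes, the only ones
  considered here.
\<close>

definition realization :: "'a set set \<Rightarrow> ('a \<Rightarrow> real) topology" where
  "realization K = subtopology (powertop_real UNIV)
     {f. (\<forall>v. 0 \<le> f v) \<and> finite {v. f v \<noteq> 0} \<and> {v. f v \<noteq> 0} \<in> K \<and>
         (\<Sum>v | f v \<noteq> 0. f v) = 1}"

definition sphere_base :: "nat \<Rightarrow> real" where
  "sphere_base = (\<lambda>i. if i = 0 then 1 else 0)"

text \<open>
  The wedge of \<open>s\<close> copies of the \<open>d\<close>-sphere, realized as the union of the coordinate axes
  in the product of the \<open>s\<close> spheres; for \<open>s = 0\<close> it is a point. That this is the disjoint union of
  the spheres with their base points identified is \<open>quotient_map_wedge\<close> below.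
\<close>

definition wedge_of_spheres :: "nat \<Rightarrow> nat \<Rightarrow> (nat \<Rightarrow> nat \<Rightarrow> real) topology" where
  "wedge_of_spheres s d = subtopology (product_topology (\<lambda>_. nsphere d) {..<s})
     {f. \<forall>i<s. \<forall>j<s. i \<noteq> j \<longrightarrow> f i = sphere_base \<or> f j = sphere_base}"

lemma sphere_base_in_nsphere: "sphere_base \<in> topspace (nsphere d)"
  by (simp add: nsphere sphere_base_def if_distrib [of "\<lambda>t. t ^ 2"] cong: if_cong)

lemma compact_space_nsphere: "compact_space (nsphere d)"
proof -
  let ?P = "powertop_real (UNIV :: nat set)"
  let ?S = "{x. (\<Sum>i\<le>d. x i ^ 2) = (1::real) \<and> (\<forall>i>d. x i = 0)}"
  have "compactin ?P (PiE UNIV (\<lambda>_. {-1..1}))"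
    by (simp add: compactin_PiE)
  moreover have "closedin ?P ?S"
  proof -
    have "continuous_map ?P euclideanreal (\<lambda>x. \<Sum>i\<le>d. x i ^ 2)"
      by (intro continuous_map_sum continuous_map_real_pow continuous_map_product_projection) auto
    then have 1: "closedin ?P {x. (\<Sum>i\<le>d. x i ^ 2) = (1::real)}"
      using closedin_continuous_map_preimage
        [of ?P euclideanreal "\<lambda>x. \<Sum>i\<le>d. x i ^ 2" "{1}"] by simp
    have 2: "closedin ?P {x. x i = 0}" for i
    proof -
      have "continuous_map ?P euclideanreal (\<lambda>x. x i)"
        by (rule continuous_map_product_projection) simp
      then show ?thesis
        using closedin_continuous_map_preimage [of ?P euclideanreal "\<lambda>x. x i" "{0}"] by simp
    qed
    have "?S = (\<Inter>i\<in>{d<..}. {x. x i = 0}) \<inter> {x. (\<Sum>i\<le>d. x i ^ 2) = 1}"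
      by auto
    moreover have "closedin ?P (\<Inter>i\<in>{d<..}. {x. x i = 0})"
      by (rule closedin_INT) (use 2 in auto)
    ultimately show ?thesis
      using 1 by (simp only: closedin_Int)
  qed
  moreover have "?S \<subseteq> PiE UNIV (\<lambda>_. {-1..1})"
  proof (intro subsetI PiE_I)
    fix x :: "nat \<Rightarrow> real" and i assume x: "x \<in> ?S"
    show "x i \<in> {-1..1}"
    proof (cases "i \<le> d")
      case True
      then have "x i ^ 2 \<le> (\<Sum>i\<le>d. x i ^ 2)"
        by (intro member_le_sum) auto
      then have "\<bar>x i\<bar> \<le> 1"
        using x by (simp add: abs_square_le_1)
      then show ?thesis by auto
    qed (use x in auto)
  qed auto
  ultimately have "compactin ?P ?S"
    by (intro closed_compactin [of ?P "PiE UNIV (\<lambda>_. {-1..1})" ?S])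
  then show ?thesis
    by (simp add: nsphere compact_space_subtopology)
qed

lemma Hausdorff_space_nsphere: "Hausdorff_space (nsphere d)"
  by (simp add: nsphere_def Hausdorff_space_subtopology Hausdorff_Euclidean_space)

definition wedge_inclusion :: "nat \<Rightarrow> nat \<times> (nat \<Rightarrow> real) \<Rightarrow> nat \<Rightarrow> nat \<Rightarrow> real" where
  "wedge_inclusion s = (\<lambda>(i, x). \<lambda>j\<in>{..<s}. if j = i then x else sphere_base)"

lemma quotient_map_wedge:
  assumes "0 < s"
  shows "quotient_map (sum_topology (\<lambda>_. nsphere d) {..<s}) (wedge_of_spheres s d) (wedge_inclusion s)"
    and "\<And>i x j y. \<lbrakk>i < s; j < s\<rbrakk> \<Longrightarrow>
           wedge_inclusion s (i, x) = wedge_inclusion s (j, y) \<longleftrightarrow>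
             (i, x) = (j, y) \<or> (x = sphere_base \<and> y = sphere_base)"
proof -
  let ?S = "sum_topology (\<lambda>_. nsphere d) {..<s}" and ?W = "wedge_of_spheres s d"
  let ?q = "wedge_inclusion s"
  have topW: "topspace ?W = {f \<in> {..<s} \<rightarrow>\<^sub>E topspace (nsphere d).
      \<forall>i<s. \<forall>j<s. i \<noteq> j \<longrightarrow> f i = sphere_base \<or> f j = sphere_base}"
    by (auto simp: wedge_of_spheres_def)
  have cont1: "continuous_map (nsphere d) ?W (\<lambda>x. ?q (i, x))" if "i < s" for i
    unfolding wedge_of_spheres_def continuous_map_in_subtopology
  proof
    have "continuous_map (nsphere d) (nsphere d) (\<lambda>x. ?q (i, x) k)" if "k < s" for k
      using that by (cases "k = i") (auto simp: wedge_inclusion_def sphere_base_in_nsphere)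
    then show "continuous_map (nsphere d) (product_topology (\<lambda>_. nsphere d) {..<s}) (\<lambda>x. ?q (i, x))"
      by (auto simp: continuous_map_componentwise wedge_inclusion_def)
  qed (auto simp: wedge_inclusion_def)
  have "Hausdorff_space ?W"
    by (simp add: wedge_of_spheres_def Hausdorff_space_subtopology
        Hausdorff_space_product_topology Hausdorff_space_nsphere)
  then have closed1: "closed_map (nsphere d) ?W (\<lambda>x. ?q (i, x))" if "i < s" for i
    by (intro continuous_imp_closed_map cont1 that compact_space_nsphere)
  have cont: "continuous_map ?S ?W ?q"
    unfolding continuous_map
  proof (intro conjI allI impI)
    show "?q ` topspace ?S \<subseteq> topspace ?W"
      using cont1 by (auto dest!: continuous_map_image_subset_topspace)
    fix U assume "openin ?W U"
    then have "openin (nsphere d) {x \<in> topspace (nsphere d). ?q (i, x) \<in> U}" if "i < s" for i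
      using cont1 [OF that] by (simp add: continuous_map)
    then show "openin ?S {z \<in> topspace ?S. ?q z \<in> U}"
      by (auto simp: openin_sum_topology)
  qed
  have "closed_map ?S ?W ?q"
    unfolding closed_map_def
  proof (intro allI impI)
    fix C assume C: "closedin ?S C"
    then have "C \<subseteq> {..<s} \<times> topspace (nsphere d)"
      using closedin_subset by fastforce
    then have "?q ` C = (\<Union>i\<in>{..<s}. (\<lambda>x. ?q (i, x)) ` {x. (i, x) \<in> C})"
      by (auto simp: image_iff)
    moreover have "closedin ?W ((\<lambda>x. ?q (i, x)) ` {x. (i, x) \<in> C})" if "i < s" for i
      using closed1 [OF that] C that by (auto simp: closed_map_def closedin_sum_topology)
    ultimately show "closedin ?W (?q ` C)"
      by (auto intro!: closedin_Union)
  qed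
  moreover have "?q ` topspace ?S = topspace ?W"
  proof
    show "topspace ?W \<subseteq> ?q ` topspace ?S"
    proof
      fix f assume f: "f \<in> topspace ?W"
      obtain i where i: "i < s" "\<And>j. j < s \<Longrightarrow> j \<noteq> i \<Longrightarrow> f j = sphere_base"
      proof (cases "\<exists>i<s. f i \<noteq> sphere_base")
        case True
        then obtain i where "i < s" "f i \<noteq> sphere_base" by blast
        with f show ?thesis unfolding topW by (intro that [of i]) auto
      qed (use that assms in blast)
      have "f \<in> extensional {..<s}"
        using f unfolding topW by (simp add: PiE_iff)
      then have "f j = ?q (i, f i) j" for j
        by (cases "j < s") (simp_all add: wedge_inclusion_def i(2) extensional_def)
      then have "f = ?q (i, f i)" by (rule ext)
      moreover have "(i, f i) \<in> topspace ?S"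
        using f i(1) unfolding topW by (simp add: PiE_iff)
      ultimately show "f \<in> ?q ` topspace ?S" by blast
    qed
  qed (rule continuous_map_image_subset_topspace [OF cont])
  ultimately show "quotient_map ?S ?W ?q"
    by (rule continuous_closed_imp_quotient_map [OF cont])
next
  fix i x j y assume ij: "i < s" "j < s"
  show "wedge_inclusion s (i, x) = wedge_inclusion s (j, y) \<longleftrightarrow>
          (i, x) = (j, y) \<or> (x = sphere_base \<and> y = sphere_base)" (is "?l = ?r")
  proof
    assume l: ?l
    show ?r
      using fun_cong [OF l, of i] fun_cong [OF l, of j] ij
      by (cases "i = j") (simp_all add: wedge_inclusion_def)
  next
    assume ?r
    then show ?l
    proof
      assume "x = sphere_base \<and> y = sphere_base"
      then show ?l by (simp add: wedge_inclusion_def cong: if_cong)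
    qed simp
  qed
qed


section \<open>Rectangular decompositions\<close>

datatype block =
    is_empty_rect: Empty_rect (block_rows: "nat set") (block_cols: "nat set")
  | is_full_rect: Full_rect (block_rows: "nat set") (block_cols: "nat set")
  | is_pedestal: Pedestal (block_rows: "nat set") (block_cols: "nat set")

definition top_cell :: "(nat \<times> nat) set \<Rightarrow> nat set \<Rightarrow> nat set \<Rightarrow> bool" where
  "top_cell D X Y \<longleftrightarrow> X \<noteq> {} \<and> Y \<noteq> {} \<and> (Min X, Max Y) \<in> bip_diagram D X Y"

definition empty_rows :: "(nat \<times> nat) set \<Rightarrow> nat set \<Rightarrow> nat set \<Rightarrow> nat set" where
  "empty_rows D X Y = {x \<in> X. \<forall>u\<in>X. u \<le> x \<longrightarrow> (\<forall>y\<in>Y. (u, y) \<notin> bip_diagram D X Y)}"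

definition empty_cols :: "(nat \<times> nat) set \<Rightarrow> nat set \<Rightarrow> nat set \<Rightarrow> nat set" where
  "empty_cols D X Y = {y \<in> Y. \<forall>v\<in>Y. y \<le> v \<longrightarrow> (\<forall>x\<in>X. (x, v) \<notin> bip_diagram D X Y)}"

definition top_rows :: "(nat \<times> nat) set \<Rightarrow> nat set \<Rightarrow> nat set \<Rightarrow> nat set" where
  "top_rows D X Y = {x \<in> X. x \<le> Max {u. (u, Max Y) \<in> bip_diagram D X Y}}"

definition top_cols :: "(nat \<times> nat) set \<Rightarrow> nat set \<Rightarrow> nat set \<Rightarrow> nat set" where
  "top_cols D X Y = {y \<in> Y. Min {v. (Min X, v) \<in> bip_diagram D X Y} \<le> y}"

definition new_excess ::
  "(nat \<times> nat) set \<Rightarrow> nat set \<Rightarrow> nat set \<Rightarrow> nat set \<Rightarrow> nat set \<Rightarrow> (nat \<times> nat) set" where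
  "new_excess D X Y X' Y' = bip_diagram D (X - X') Y' \<union> bip_diagram D X' (Y - Y')"

text \<open>
  The result consists of the rectangles and pedestal in the order in which they are found, and
  of the set of excess cells. For infinite \<open>X\<close> or \<open>Y\<close> the value is irrelevant. The branch
  where both \<open>empty_rows\<close> and \<open>empty_cols\<close> are empty only serves to make the recursion
  terminate for arbitrary \<open>D\<close>; see \<open>no_top_cell_progress\<close> below.
\<close>

function rect_decomp ::
  "(nat \<times> nat) set \<Rightarrow> nat set \<Rightarrow> nat set \<Rightarrow> block list \<times> (nat \<times> nat) set" where
  "rect_decomp D X Y =
    (if infinite X \<or> infinite Y \<or> (X = {} \<and> Y = {}) then ([], {})
     else if \<not> top_cell D X Y then
       (let X' = empty_rows D X Y; Y' = empty_cols D X Y in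
        if X' = {} \<and> Y' = {} then ([], {})
        else apfst ((#) (Empty_rect X' Y')) (rect_decomp D (X - X') (Y - Y')))
     else
       (let X' = top_rows D X Y; Y' = top_cols D X Y in
        if (Max X', Min Y') \<in> bip_diagram D X Y
        then map_prod ((#) (Full_rect X' Y')) ((\<union>) (new_excess D X Y X' Y'))
               (rect_decomp D (X - X') (Y - Y'))
        else ([Pedestal X' Y'], new_excess D X Y X' Y')))"
  by pat_completeness auto

lemma top_rows_nonempty:
  assumes "finite X" "top_cell D X Y" shows "Min X \<in> top_rows D X Y"
proof -
  have "finite {u. (u, Max Y) \<in> bip_diagram D X Y}"
    by (rule finite_subset [OF _ assms(1)]) (auto simp: bip_diagram_def)
  then show ?thesis
    using assms by (auto simp: top_cell_def top_rows_def)
qed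

lemma card_Diff_less:
  assumes "finite X" "finite Y" "X' \<subseteq> X" "Y' \<subseteq> Y" "X' \<noteq> {} \<or> Y' \<noteq> {}"
  shows "card (X - X') + card (Y - Y') < card X + card Y"
proof -
  have "card (X - X') \<le> card X" "card (Y - Y') \<le> card Y"
    using assms by (auto intro: card_mono)
  moreover have "card (X - X') < card X \<or> card (Y - Y') < card Y"
    using assms by (metis psubset_card_mono Diff_subset Diff_eq_empty_iff double_diff psubsetI Diff_cancel order_refl)
  ultimately show ?thesis by linarith
qed

termination rect_decomp
proof (relation "Wellfounded.measure (\<lambda>(D, X, Y). card X + card Y)", goal_cases)
  case (2 D X Y X' Y')
  then show ?case
    by (auto simp: empty_rows_def empty_cols_def intro!: card_Diff_less)
next
  case (3 D X Y X' Y')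
  then have "X' \<noteq> {}" using top_rows_nonempty by blast
  with 3 show ?case
    by (auto simp: top_rows_def top_cols_def intro!: card_Diff_less)
qed simp

declare rect_decomp.simps [simp del]

lemma no_top_cell_progress:
  assumes D: "shifted_skew_diagram D" and fin: "finite X" "finite Y"
    and ne: "X \<noteq> {} \<or> Y \<noteq> {}" and top: "\<not> top_cell D X Y"
  shows "empty_rows D X Y \<noteq> {} \<or> empty_cols D X Y \<noteq> {}"
proof (rule ccontr)
  assume "\<not> ?thesis"
  then have er: "empty_rows D X Y = {}" and ec: "empty_cols D X Y = {}" by auto
  have "X \<noteq> {}" "Y \<noteq> {}"
    using er ec ne by (auto simp: empty_rows_def empty_cols_def bip_diagram_def)
  then have mX: "Min X \<in> X" "\<And>x. x \<in> X \<Longrightarrow> Min X \<le> x" and mY: "Max Y \<in> Y" "\<And>y. y \<in> Y \<Longrightarrow> y \<le> Max Y"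
    using fin by auto
  obtain y where y: "y \<in> Y" "(Min X, y) \<in> D"
  proof -
    have "Min X \<notin> empty_rows D X Y" using er by simp
    then obtain u v where "u \<in> X" "u \<le> Min X" "(u, v) \<in> bip_diagram D X Y"
      using mX by (auto simp: empty_rows_def)
    moreover from this have "u = Min X" using mX by (simp add: order_antisym)
    ultimately show thesis using that by (auto simp: bip_diagram_def)
  qed
  obtain x where x: "x \<in> X" "(x, Max Y) \<in> D"
  proof -
    have "Max Y \<notin> empty_cols D X Y" using ec by simp
    then obtain u v where "v \<in> Y" "Max Y \<le> v" "(u, v) \<in> bip_diagram D X Y"
      using mY by (auto simp: empty_cols_def)
    moreover from this have "v = Max Y" using mY by (simp add: order_antisym)
    ultimately show thesis using that by (auto simp: bip_diagram_def)
  qed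
  obtain l lam mu where lam: "strict_antimono_on {1..l} lam"
    and D_eq: "D = {(i, j). 1 \<le> i \<and> i \<le> l \<and> i + mu i + 1 \<le> j \<and> j \<le> i + (lam i :: nat)}"
    using D by (auto simp: shifted_skew_diagram_def)
  have mono: "k + lam k \<le> i + lam i" if "i \<le> k" "1 \<le> i" "k \<le> l" for i k
    using that
  proof (induction k rule: dec_induct)
    case (step k)
    then have "lam (Suc k) < lam k"
      using lam by (auto simp: monotone_on_def)
    with step show ?case by auto
  qed auto
  have "x + lam x \<le> Min X + lam (Min X)"
    using mono [of "Min X" x] mX(2) [OF x(1)] x y by (auto simp: D_eq)
  then have "(Min X, Max Y) \<in> D"
    using x y mY(2) [OF y(1)] by (auto simp: D_eq)
  then show False
    using top mX mY \<open>X \<noteq> {}\<close> \<open>Y \<noteq> {}\<close> by (simp add: top_cell_def bip_diagram_def)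
qed

definition count_rect :: "block list \<Rightarrow> nat" where
  "count_rect bs = length (filter is_full_rect bs) + length (filter is_pedestal bs)"

definition spherical :: "(nat \<times> nat) set \<Rightarrow> nat set \<Rightarrow> nat set \<Rightarrow> bool" where
  "spherical D X Y \<longleftrightarrow> (\<forall>b\<in>set (fst (rect_decomp D X Y)). \<not> is_empty_rect b \<and> \<not> is_pedestal b)"

definition bip_rect :: "(nat \<times> nat) set \<Rightarrow> nat set \<Rightarrow> nat set \<Rightarrow> nat" where
  "bip_rect D X Y = count_rect (fst (rect_decomp D X Y))"

text \<open>
  The decomposition of \<open>nonbip_diagram D X\<close> is that of \<open>bip_diagram D X X\<close>, but viewed in the
  shifted plane, which has no positions below the diagonal: a rectangle all of whose positions
  are below the diagonal is not part of it. Such a rectangle can only be an empty one, left over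
  after every element of \<open>X\<close> has already been used as a row or a column of an earlier rectangle.
  For instance, if \<open>X = {1,2}\<close> and \<open>(1,2) \<in> D\<close>, then the full rectangle \<open>{1} \<times> {2}\<close> leaves row \<open>2\<close>
  and column \<open>1\<close>. The complex of the graph is a \<open>0\<close>-sphere, so \<open>{2} \<times> {1}\<close> must not count as an
  empty rectangle. Rectangles without rows or without columns have no positions at all; they
  are kept.
\<close>

definition below_diagonal :: "block \<Rightarrow> bool" where
  "below_diagonal b \<longleftrightarrow> block_rows b \<noteq> {} \<and> block_cols b \<noteq> {} \<and>
     (\<forall>x\<in>block_rows b. \<forall>y\<in>block_cols b. y < x)"

definition nonbip_blocks :: "(nat \<times> nat) set \<Rightarrow> nat set \<Rightarrow> block list" where
  "nonbip_blocks D X = filter (\<lambda>b. \<not> below_diagonal b) (fst (rect_decomp D X X))"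

definition nonbip_excess :: "(nat \<times> nat) set \<Rightarrow> nat set \<Rightarrow> (nat \<times> nat) set" where
  "nonbip_excess D X = snd (rect_decomp D X X)"

definition nonbip_rect :: "(nat \<times> nat) set \<Rightarrow> nat set \<Rightarrow> nat" where
  "nonbip_rect D X = count_rect (nonbip_blocks D X)"

end

theory Submission
  imports Defs
begin

text \<open>
  The complexes are shrunk by folding. If all neighbors of a vertex \<open>u\<close> are neighbors of a vertex
  \<open>v\<close>, then deleting \<open>v\<close> does not change the homotopy type of the independence complex
  (\<open>fold_dominated\<close>). The rectangular decomposition tells which vertices to delete. The
  shape of the diagram enters through two facts: a north-west and a south-east corner fill the
  part of their rectangle above the diagonal (\<open>shifted_skew_diagram_convex\<close>), and if there is no
  top cell, then the first row or the last column is empty (\<open>no_top_cell_progress\<close>).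

  In a full rectangle the first row has its cells in the columns of the rectangle only, and all
  other rows of the rectangle have cells in all of these columns. So the first row dominates the
  other rows, likewise the last column dominates the other columns, and the rectangle folds to a single edge
  that is not joined to the rest of the graph (\<open>full_block_cross\<close>). In a pedestal of the bipartite
  graph folding makes the leftmost column an isolated vertex. In a pedestal of the nonbipartite
  graph the vertices that are both a row and a column of the pedestal, together with the first and
  the last vertex, span a complete graph to which the rest can be folded. At an empty
  rectangle the remaining graph has an isolated vertex, unless the rectangle consists of leftovers
  below the diagonal.

  As folds stay available when disjoint pieces are added to a graph, the whole graph folds either to
  one with an isolated vertex, whose complex is a cone, or to \<open>k\<close> disjoint edges and a disjoint
  complete graph on \<open>s + 1 \<ge> 2\<close> vertices. Here \<open>k + 1\<close> is the rectangularity, since the complete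
  graph comes from the last rectangle or from the pedestal, and \<open>s\<close> is the number of non-excess staircase cells
  in the nonbipartite case, and \<open>1\<close> in the bipartite case (\<open>bip_reduction\<close>, \<open>nonbip_reduction\<close>).

  The independence complex of this last graph is the join of a \<open>(k - 1)\<close>-sphere with \<open>s + 1\<close> points, or
  \<open>s + 1\<close> balls with a common boundary. Collapsing one of the balls leaves a wedge of \<open>s\<close> spheres of
  dimension \<open>k\<close> (\<open>cross_space_homotopy_equivalent_wedge\<close>).
\<close>

section \<open>Deformations of geometric realizations\<close>

lemma realization_sum:
  assumes "f \<in> topspace (realization K)" "finite V" "{v. f v \<noteq> 0} \<subseteq> V"
  shows "sum f V = 1"
proof -
  have "sum f {v. f v \<noteq> 0} = sum f V"
    by (rule sum.mono_neutral_left) (use assms(2,3) in auto)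
  then show ?thesis using assms(1) by (simp add: realization_def)
qed

lemma in_realization_iff:
  assumes "finite V" "\<And>F. F \<in> K \<Longrightarrow> F \<subseteq> V"
  shows "f \<in> topspace (realization K) \<longleftrightarrow> (\<forall>v. 0 \<le> f v) \<and> {v. f v \<noteq> 0} \<in> K \<and> sum f V = 1"
proof -
  have "finite {v. f v \<noteq> 0} \<and> (\<Sum>v | f v \<noteq> 0. f v) = sum f V" if "{v. f v \<noteq> 0} \<in> K"
    using assms that by (auto intro: finite_subset intro!: sum.mono_neutral_left)
  then show ?thesis by (auto simp: realization_def)
qed

lemma continuous_map_coordinate:
  "continuous_map (realization K) euclideanreal (\<lambda>f. f v)"
  unfolding realization_def
  by (intro continuous_map_from_subtopology continuous_map_product_projection) auto

lemma continuous_map_into_realization: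
  assumes "\<And>v. continuous_map X euclideanreal (\<lambda>x. h x v)"
    and "\<And>x. x \<in> topspace X \<Longrightarrow> h x \<in> topspace (realization K)"
  shows "continuous_map X (realization K) h"
proof -
  have "continuous_map X (powertop_real UNIV) h"
    using assms(1) by (simp add: continuous_map_componentwise_UNIV)
  moreover have "h x \<in> {f. (\<forall>v. 0 \<le> f v) \<and> finite {v. f v \<noteq> 0} \<and> {v. f v \<noteq> 0} \<in> K \<and>
         (\<Sum>v | f v \<noteq> 0. f v) = 1}" if "x \<in> topspace X" for x
    using assms(2)[OF that] unfolding realization_def topspace_subtopology by blast
  ultimately show ?thesis
    unfolding realization_def by (intro continuous_map_into_subtopology) blast+
qed

lemma continuous_map_fst_interval:
  "continuous_map (prod_topology (top_of_set {0..1::real}) X) euclideanreal fst"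
  by (rule continuous_map_into_fulltopology[OF continuous_map_fst])

lemma continuous_map_coordinate_snd:
  "continuous_map (prod_topology T (realization K)) euclideanreal (\<lambda>z. snd z v)"
  using continuous_map_compose[OF continuous_map_snd continuous_map_coordinate]
  by (simp add: o_def)

definition down_closed :: "'a set set \<Rightarrow> bool" where
  "down_closed K \<longleftrightarrow> (\<forall>F\<in>K. \<forall>G\<subseteq>F. G \<in> K)"

lemma down_closed_indep_complex: "down_closed (indep_complex G)"
  by (auto simp: down_closed_def indep_complex_def)

lemma segment_in_realization:
  assumes K: "down_closed K" and f: "f \<in> topspace (realization K)"
    and g: "g \<in> topspace (realization K)" and t: "0 \<le> t" "t \<le> 1"
    and F: "{v. f v \<noteq> 0} \<union> {v. g v \<noteq> 0} \<in> K"
  shows "(\<lambda>v. (1 - t) * f v + t * g v) \<in> topspace (realization K)"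
proof -
  let ?h = "\<lambda>v. (1 - t) * f v + t * g v"
  let ?V = "{v. f v \<noteq> 0} \<union> {v. g v \<noteq> 0}"
  have fin: "finite ?V" using f g by (simp add: realization_def)
  have sub: "{v. ?h v \<noteq> 0} \<subseteq> ?V" by auto
  then have "{v. ?h v \<noteq> 0} \<in> K" using K F unfolding down_closed_def by blast
  moreover have "0 \<le> ?h v" for v using f g t by (simp add: realization_def)
  moreover have "(\<Sum>v | ?h v \<noteq> 0. ?h v) = sum ?h ?V"
    using fin sub by (intro sum.mono_neutral_left) auto
  moreover have "sum ?h ?V = (1 - t) * sum f ?V + t * sum g ?V"
    by (simp add: sum.distrib sum_distrib_left)
  moreover have "sum f ?V = 1" "sum g ?V = 1"
    using realization_sum[OF f fin] realization_sum[OF g fin] by auto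
  moreover have "finite {v. ?h v \<noteq> 0}" using sub fin finite_subset by blast
  ultimately show ?thesis
    unfolding realization_def by (simp del: add_eq_0_iff)
qed

text \<open>
  A coordinate that does not vanish on a segment does not vanish at one of its ends. Hence a face
  that carries both ends carries the whole segment.
\<close>

lemma homotopic_with_straight_line:
  assumes K: "down_closed K" and r: "continuous_map X (realization K) r"
    and q: "continuous_map X (realization K) q"
    and F: "\<And>x. x \<in> topspace X \<Longrightarrow> {v. r x v \<noteq> 0} \<union> {v. q x v \<noteq> 0} \<in> K"
  shows "homotopic_with (\<lambda>x. True) X (realization K) r q"
proof -
  let ?T = "prod_topology (top_of_set {0..1::real}) X"
  have coord: "continuous_map ?T euclideanreal (\<lambda>z. g (snd z) v)"
    if "continuous_map X (realization K) g" for g v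
    using continuous_map_compose[OF continuous_map_snd
        continuous_map_compose[OF that continuous_map_coordinate]] by (simp add: o_def)
  have "continuous_map ?T (realization K) (\<lambda>z v. (1 - fst z) * r (snd z) v + fst z * q (snd z) v)"
  proof (rule continuous_map_into_realization)
    fix v show "continuous_map ?T euclideanreal (\<lambda>z. (1 - fst z) * r (snd z) v + fst z * q (snd z) v)"
      by (intro continuous_intros continuous_map_fst_interval coord r q)
  next
    fix z assume z: "z \<in> topspace ?T"
    have "g (snd z) \<in> topspace (realization K)" if "continuous_map X (realization K) g" for g
      using that z by (auto simp: continuous_map_def)
    then show "(\<lambda>v. (1 - fst z) * r (snd z) v + fst z * q (snd z) v) \<in> topspace (realization K)"
      using z r q by (intro segment_in_realization K F) auto
  qed
  then show ?thesis
    by (subst homotopic_with) (force intro!: exI ext)+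
qed

text \<open>
  This is the form in which straight-line homotopies are used for shrinking a complex: the
  carrier condition makes the retraction \<open>r\<close> homotopic to the identity of the larger space.
\<close>

lemma homotopy_equivalent_linear_retract:
  assumes K: "down_closed K" and LK: "L \<subseteq> K"
    and r: "continuous_map (realization K) (realization L) r"
    and id: "\<And>f. f \<in> topspace (realization L) \<Longrightarrow> r f = f"
    and F: "\<And>f. f \<in> topspace (realization K) \<Longrightarrow> {v. f v \<noteq> 0} \<union> {v. r f v \<noteq> 0} \<in> K"
  shows "realization K homotopy_equivalent_space realization L"
proof -
  have inc: "continuous_map (realization L) (realization K) id"
    using LK by (intro continuous_map_into_realization)
      (use continuous_map_coordinate in \<open>auto simp: realization_def\<close>)
  have r': "continuous_map (realization K) (realization K) r"
    using continuous_map_compose[OF r inc] by simp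
  have "homotopic_with (\<lambda>x. True) (realization K) (realization K) r id"
    using F by (intro homotopic_with_straight_line K r') (auto simp: Un_commute)
  moreover have "homotopic_with (\<lambda>x. True) (realization L) (realization L) r id"
    using continuous_map_compose[OF inc r] id by (intro homotopic_with_equal) auto
  ultimately show ?thesis
    unfolding homotopy_equivalent_space_def using r inc by (metis comp_id id_comp)
qed

text \<open>
  All points can be pulled along straight lines to the vertex \<open>u\<close>, which is a cone point.
\<close>

lemma contractible_cone:
  assumes K: "down_closed K" and ne: "K \<noteq> {}" and cone: "\<And>F. F \<in> K \<Longrightarrow> insert u F \<in> K"
  shows "contractible_space (realization K)"
proof -
  let ?p = "\<lambda>v. if v = u then 1 else 0 :: real"
  have "{u} \<in> K" using K ne cone unfolding down_closed_def by blast
  moreover have "{v. ?p v \<noteq> 0} = {u}" by auto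
  ultimately have p: "?p \<in> topspace (realization K)"
    by (simp add: realization_def)
  have "{v. f v \<noteq> 0} \<union> {v. ?p v \<noteq> 0} = insert u {v. f v \<noteq> 0}" for f :: "'a \<Rightarrow> real" by auto
  then have "homotopic_with (\<lambda>x. True) (realization K) (realization K) id (\<lambda>x. ?p)"
    using p cone by (intro homotopic_with_straight_line K) (auto simp: realization_def)
  then show ?thesis unfolding contractible_space_def by blast
qed

section \<open>Folding away dominated vertices\<close>

text \<open>
  An edge given as a set with one element would be a loop; it would make its end unusable in
  every face, and a loop at the dominating vertex would spoil folding.
\<close>

definition simple_edges :: "'a set set \<Rightarrow> bool" where
  "simple_edges E \<longleftrightarrow> (\<forall>e\<in>E. \<exists>p q. p \<noteq> q \<and> e = {p, q})"

lemma indep_complexI: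
  assumes "simple_edges E" "F \<subseteq> V" "\<And>p q. p \<in> F \<Longrightarrow> q \<in> F \<Longrightarrow> {p, q} \<notin> E"
  shows "F \<in> indep_complex (V, E)"
  using assms unfolding indep_complex_def simple_edges_def by fastforce

text \<open>
  If every neighbor of \<open>u\<close> is a neighbor of \<open>v\<close>, then a face that contains \<open>v\<close> contains no
  neighbor of \<open>u\<close>, so it stays a face when \<open>u\<close> is added. The barycentric coordinate of \<open>v\<close> can
  therefore be moved to \<open>u\<close> in a straight line.
\<close>

lemma fold_dominated:
  assumes E: "simple_edges E" and V: "finite V" and uv: "u \<in> V" "v \<in> V" "u \<noteq> v"
    and dom: "\<And>w. w \<in> V \<Longrightarrow> {u, w} \<in> E \<Longrightarrow> {v, w} \<in> E"
  shows "realization (indep_complex (V, E)) homotopy_equivalent_space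
         realization (indep_complex (V - {v}, E))"
proof -
  let ?K = "indep_complex (V, E)" and ?L = "indep_complex (V - {v}, E)"
  let ?r = "\<lambda>f. f(v := 0, u := f u + f v) :: 'a \<Rightarrow> real"
  have LK: "?L \<subseteq> ?K" by (auto simp: indep_complex_def)
  have KV: "F \<subseteq> V" if "F \<in> ?K" for F using that by (auto simp: indep_complex_def)
  have LV: "F \<subseteq> V" if "F \<in> ?L" for F using that by (auto simp: indep_complex_def)
  have ins: "insert u F \<in> ?K" if F: "F \<in> ?K" "v \<in> F" for F
  proof (rule indep_complexI[OF E])
    show "insert u F \<subseteq> V" using F uv by (auto simp: indep_complex_def)
    have nF: "{p, q} \<notin> E" if "p \<in> F" "q \<in> F" for p q
      using that F(1) by (auto simp: indep_complex_def)
    have nu: "{u, q} \<notin> E" if "q \<in> F" for q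
      using dom[of q] nF[OF F(2) that] KV[OF F(1)] that by auto
    have "{u, u} \<notin> E" using E unfolding simple_edges_def by (metis doubleton_eq_iff)
    then show "{p, q} \<notin> E" if "p \<in> insert u F" "q \<in> insert u F" for p q
      using that nF nu by (metis insert_commute insertE)
  qed
  have K: "down_closed ?K" and L: "down_closed ?L" by (rule down_closed_indep_complex)+
  have supp: "{w. f w \<noteq> 0} \<union> {w. ?r f w \<noteq> 0} \<in> ?K" if f: "f \<in> topspace (realization ?K)" for f
  proof (cases "f v = 0")
    case True
    then have "?r f = f" by auto
    then show ?thesis using f by (simp add: realization_def)
  next
    case False
    then have "insert u {w. f w \<noteq> 0} \<in> ?K" using f by (intro ins) (auto simp: realization_def)
    moreover have "{w. f w \<noteq> 0} \<union> {w. ?r f w \<noteq> 0} \<subseteq> insert u {w. f w \<noteq> 0}" by auto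
    ultimately show ?thesis using K unfolding down_closed_def by blast
  qed
  have rin: "?r f \<in> topspace (realization ?L)" if f: "f \<in> topspace (realization ?K)" for f
  proof -
    have f0: "0 \<le> f w" for w using f by (simp add: realization_def)
    have "{w. ?r f w \<noteq> 0} \<in> ?K" using supp[OF f] K unfolding down_closed_def by blast
    moreover have "v \<notin> {w. ?r f w \<noteq> 0}" using uv(3) by simp
    ultimately have "{w. ?r f w \<noteq> 0} \<in> ?L"
      unfolding indep_complex_def by (simp add: subset_Diff_insert del: fun_upd_apply)
    moreover have "sum (?r f) V = sum f V"
    proof -
      have "sum g V = g u + (g v + sum g (V - {u} - {v}))" for g :: "'a \<Rightarrow> real"
        using V uv by (simp add: sum.remove[of V u] sum.remove[of "V - {u}" v])
      from this[of f] this[of "?r f"] show ?thesis using uv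
        by (simp add: sum.cong[of "V - {u} - {v}" "V - {u} - {v}" "?r f" f])
    qed
    moreover have "sum f V = 1" using f in_realization_iff[OF V KV] by simp
    ultimately show ?thesis using f0 in_realization_iff[OF V LV, where f = "?r f"] by simp
  qed
  show ?thesis
  proof (rule homotopy_equivalent_linear_retract[OF K LK _ _ supp])
    show "continuous_map (realization ?K) (realization ?L) ?r"
    proof (rule continuous_map_into_realization[OF _ rin])
      fix w
      show "continuous_map (realization ?K) euclideanreal (\<lambda>f. ?r f w)"
        using uv(3) by (cases "w = u"; cases "w = v")
          (auto intro!: continuous_map_add continuous_map_coordinate)
    qed
    fix f assume "f \<in> topspace (realization ?L)"
    then have "f v = 0" by (auto simp: realization_def indep_complex_def)
    then show "?r f = f" by auto
  qed
qed

lemma indep_complex_induced: "indep_complex (V, {e \<in> E. e \<subseteq> V}) = indep_complex (V, E)"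
proof -
  have "(\<forall>e\<in>{e \<in> E. e \<subseteq> V}. \<not> e \<subseteq> F) \<longleftrightarrow> (\<forall>e\<in>E. \<not> e \<subseteq> F)" if "F \<subseteq> V" for F
  proof (intro iffI ballI notI)
    fix e assume all: "\<forall>e\<in>{e \<in> E. e \<subseteq> V}. \<not> e \<subseteq> F" and e: "e \<in> E" "e \<subseteq> F"
    then have "e \<in> {e \<in> E. e \<subseteq> V}" using order_trans[OF e(2) that] by simp
    then show False using all e(2) by blast
  qed simp
  then show ?thesis unfolding indep_complex_def fst_conv snd_conv by (intro Collect_cong conj_cong refl)
qed

text \<open>
  Sequences of folds are recorded as a relation between vertex sets, since they are to be
  replayed inside larger graphs; a homotopy equivalence alone would not transfer.
  The edges need not lie in the vertex set, so that passing to an induced subgraph only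
  changes the vertex set.
\<close>

inductive folds_to :: "'a set set \<Rightarrow> 'a set \<Rightarrow> 'a set \<Rightarrow> bool" for E where
  folds_refl: "folds_to E V V"
| folds_step: "folds_to E (V - {v}) W \<Longrightarrow> u \<in> V \<Longrightarrow> v \<in> V \<Longrightarrow> u \<noteq> v \<Longrightarrow>
    (\<And>w. w \<in> V \<Longrightarrow> {u, w} \<in> E \<Longrightarrow> {v, w} \<in> E) \<Longrightarrow> folds_to E V W"

lemma folds_to_homotopy_equivalent:
  assumes "folds_to E V W" "simple_edges E" "finite V"
  shows "realization (indep_complex (V, E)) homotopy_equivalent_space
         realization (indep_complex (W, E))"
  using assms
proof (induction rule: folds_to.induct)
  case (folds_step V v W u)
  then show ?case
    using homotopy_eqv_trans[OF fold_dominated[of E V u v]] by simp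
qed (rule homotopy_equivalent_space_refl)

lemma folds_to_subset: "folds_to E V W \<Longrightarrow> W \<subseteq> V"
  by (induction rule: folds_to.induct) auto

lemma folds_to_trans: "folds_to E U V \<Longrightarrow> folds_to E V W \<Longrightarrow> folds_to E U W"
proof (induction rule: folds_to.induct)
  case (folds_step U v V u)
  then show ?case by (intro folds_to.folds_step[of E U v W u])
qed

lemma folds_to_remove_dominated:
  assumes "finite S" "S \<subseteq> V" "u \<in> V - S"
    and "\<And>v w. v \<in> S \<Longrightarrow> w \<in> V \<Longrightarrow> {u, w} \<in> E \<Longrightarrow> {v, w} \<in> E"
  shows "folds_to E V (V - S)"
  using assms
proof (induction S arbitrary: V rule: finite_induct)
  case (insert v S)
  have "V - insert v S = (V - {v}) - S" by auto
  moreover have "folds_to E (V - {v}) ((V - {v}) - S)"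
    using insert.prems insert.hyps by (intro insert.IH) auto
  ultimately show ?case
    using insert.prems by (intro folds_step[of E V v _ u]) auto
qed (simp add: folds_refl)

text \<open>
  Neighborhoods of vertices of \<open>V\<close> do not change when a part of the graph is added that is not
  joined to \<open>V\<close>, so folds remain available.
\<close>

lemma folds_to_disjoint_union:
  assumes "folds_to E V W" "P \<inter> V = {}" "\<And>p v. p \<in> P \<Longrightarrow> v \<in> V \<Longrightarrow> {v, p} \<notin> E"
  shows "folds_to E (P \<union> V) (P \<union> W)"
  using assms
proof (induction rule: folds_to.induct)
  case (folds_step V v W u)
  have "(P \<union> V) - {v} = P \<union> (V - {v})" using folds_step by auto
  moreover have "folds_to E (P \<union> (V - {v})) (P \<union> W)"
    using folds_step.prems by (intro folds_step.IH) auto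
  ultimately show ?case
    using folds_step.hyps folds_step.prems by (intro folds_to.folds_step[of E "P \<union> V" v _ u]) auto
qed (rule folds_refl)

lemma contractible_isolated_vertex:
  assumes E: "simple_edges E" and u: "u \<in> V" "\<And>w. w \<in> V \<Longrightarrow> {u, w} \<notin> E"
  shows "contractible_space (realization (indep_complex (V, E)))"
proof (rule contractible_cone[OF down_closed_indep_complex])
  have "{} \<in> indep_complex (V, E)" by (rule indep_complexI[OF E]) auto
  then show "indep_complex (V, E) \<noteq> {}" by auto
  fix F assume F: "F \<in> indep_complex (V, E)"
  then have FV: "F \<subseteq> V" and nF: "\<And>p q. p \<in> F \<Longrightarrow> q \<in> F \<Longrightarrow> {p, q} \<notin> E"
    by (auto simp: indep_complex_def)
  show "insert u F \<in> indep_complex (V, E)"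
    using FV nF u by (intro indep_complexI[OF E]) (auto, metis insert_commute subsetD)
qed

section \<open>The independence complex of disjoint edges and a clique\<close>

datatype cross_vertex = Pos nat | Neg nat | Apex nat

text \<open>
  The graph consists of the \<open>k\<close> edges from \<open>Pos i\<close> to \<open>Neg i\<close> for \<open>1 \<le> i \<le> k\<close> and of a complete
  graph on \<open>Apex 0, \<dots>, Apex s\<close>. The first part has the boundary of a \<open>k\<close>-dimensional cross
  polytope as its independence complex, that is, a sphere of dimension \<open>k - 1\<close>; the second part
  has \<open>s + 1\<close> isolated points. The whole complex is their join: \<open>s + 1\<close> cones over the same
  sphere, glued along their bases.
\<close>

definition cross_vertices :: "nat \<Rightarrow> nat \<Rightarrow> cross_vertex set" where
  "cross_vertices k s = Pos ` {1..k} \<union> Neg ` {1..k} \<union> Apex ` {..s}"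

definition cross_edges :: "cross_vertex set set" where
  "cross_edges = {{Pos i, Neg i} | i. True} \<union> {{Apex i, Apex j} | i j. i \<noteq> j}"

definition cross_complex :: "nat \<Rightarrow> nat \<Rightarrow> cross_vertex set set" where
  "cross_complex k s = indep_complex (cross_vertices k s, cross_edges)"

lemma finite_cross_vertices: "finite (cross_vertices k s)"
  by (simp add: cross_vertices_def)

lemma cross_complex_subset: "F \<in> cross_complex k s \<Longrightarrow> F \<subseteq> cross_vertices k s"
  by (auto simp: cross_complex_def indep_complex_def)

lemma in_cross_complex_iff:
  "F \<in> cross_complex k s \<longleftrightarrow> F \<subseteq> cross_vertices k s \<and>
     (\<forall>i. Pos i \<in> F \<longrightarrow> Neg i \<notin> F) \<and> (\<forall>i j. Apex i \<in> F \<longrightarrow> Apex j \<in> F \<longrightarrow> i = j)"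
proof -
  have "(\<forall>e\<in>cross_edges. \<not> e \<subseteq> F) \<longleftrightarrow> (\<forall>i. \<not> {Pos i, Neg i} \<subseteq> F) \<and> (\<forall>i j. i \<noteq> j \<longrightarrow> \<not> {Apex i, Apex j} \<subseteq> F)"
    unfolding cross_edges_def by blast
  then show ?thesis unfolding cross_complex_def indep_complex_def by auto
qed

abbreviation cross_space :: "nat \<Rightarrow> nat \<Rightarrow> (cross_vertex \<Rightarrow> real) topology" where
  "cross_space k s \<equiv> realization (cross_complex k s)"

lemma sum_cross_vertices:
  "sum f (cross_vertices k s) = (\<Sum>i=1..k. f (Pos i) + f (Neg i)) + f (Apex 0) + (\<Sum>j<s. f (Apex (Suc j)))"
proof -
  have disj: "(Pos ` {1..k} \<union> Neg ` {1..k}) \<inter> Apex ` {..s} = {}" "Pos ` {1..k} \<inter> Neg ` {1..k} = {}"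
    by auto
  have "sum f (cross_vertices k s) = sum f (Pos ` {1..k}) + sum f (Neg ` {1..k}) + sum f (Apex ` {..s})"
    unfolding cross_vertices_def using disj
    by (simp only: sum.union_disjoint finite_UnI finite_imageI finite_atLeastAtMost finite_atMost)
  also have "\<dots> = (\<Sum>i=1..k. f (Pos i)) + (\<Sum>i=1..k. f (Neg i)) + (\<Sum>j\<le>s. f (Apex j))"
    by (simp add: sum.reindex inj_on_def o_def)
  also have "(\<Sum>j\<le>s. f (Apex j)) = f (Apex 0) + (\<Sum>j<s. f (Apex (Suc j)))"
    by (rule sum.atMost_shift)
  finally show ?thesis by (simp only: sum.distrib add.assoc)
qed

text \<open>
  In the coordinates \<open>x\<^sub>i = f (Pos i) - f (Neg i)\<close> and \<open>t\<^sub>j = f (Apex j)\<close> a point of the complex is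
  a vector \<open>x\<close> together with at most one nonzero \<open>t\<^sub>j\<close>, subject to \<open>\<bar>x\<bar> + t\<^sub>j = 1\<close> in the \<open>l\<^sub>1\<close>-norm.
\<close>

lemma in_cross_space_iff:
  "f \<in> topspace (cross_space k s) \<longleftrightarrow>
     (\<forall>v. 0 \<le> f v) \<and> (\<forall>v. v \<notin> cross_vertices k s \<longrightarrow> f v = 0) \<and>
     (\<forall>i. f (Pos i) = 0 \<or> f (Neg i) = 0) \<and>
     (\<forall>i j. i \<noteq> j \<longrightarrow> f (Apex i) = 0 \<or> f (Apex j) = 0) \<and> sum f (cross_vertices k s) = 1"
proof -
  have 1: "f \<in> topspace (cross_space k s) \<longleftrightarrow>
      (\<forall>v. 0 \<le> f v) \<and> {v. f v \<noteq> 0} \<in> cross_complex k s \<and> sum f (cross_vertices k s) = 1"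
    by (rule in_realization_iff) (simp_all add: finite_cross_vertices cross_complex_subset)
  have 2: "{v. f v \<noteq> 0} \<subseteq> cross_vertices k s \<longleftrightarrow> (\<forall>v. v \<notin> cross_vertices k s \<longrightarrow> f v = 0)"
    by auto
  have 3: "(\<forall>i. Pos i \<in> {v. f v \<noteq> 0} \<longrightarrow> Neg i \<notin> {v. f v \<noteq> 0}) \<longleftrightarrow> (\<forall>i. f (Pos i) = 0 \<or> f (Neg i) = 0)"
    by auto
  have 4: "(\<forall>i j. Apex i \<in> {v. f v \<noteq> 0} \<longrightarrow> Apex j \<in> {v. f v \<noteq> 0} \<longrightarrow> i = j) \<longleftrightarrow>
      (\<forall>i j. i \<noteq> j \<longrightarrow> f (Apex i) = 0 \<or> f (Apex j) = 0)"
    unfolding mem_Collect_eq by meson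
  show ?thesis unfolding 1 in_cross_complex_iff 2 3 4 by (simp only: conj_assoc)
qed

text \<open>
  Maps into the realization are obtained from nowhere vanishing unnormalized coordinates by
  scaling, and maps into the sphere likewise.
\<close>

definition scale1 :: "nat \<Rightarrow> nat \<Rightarrow> (cross_vertex \<Rightarrow> real) \<Rightarrow> cross_vertex \<Rightarrow> real" where
  "scale1 k s g = (\<lambda>v. g v / sum g (cross_vertices k s))"

text \<open>
  The open cone over the realization: the points that \<open>scale1\<close> can normalize.
\<close>

definition cross_cone :: "nat \<Rightarrow> nat \<Rightarrow> (cross_vertex \<Rightarrow> real) set" where
  "cross_cone k s = {g. (\<forall>v. 0 \<le> g v) \<and> (\<forall>v. v \<notin> cross_vertices k s \<longrightarrow> g v = 0) \<and>
     (\<forall>i. g (Pos i) = 0 \<or> g (Neg i) = 0) \<and>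
     (\<forall>i j. i \<noteq> j \<longrightarrow> g (Apex i) = 0 \<or> g (Apex j) = 0) \<and> (\<exists>v. g v \<noteq> 0)}"

lemma cross_cone_sum_pos: 
  assumes "g \<in> cross_cone k s" shows "0 < sum g (cross_vertices k s)"
proof -
  obtain v where "g v \<noteq> 0" "v \<in> cross_vertices k s" "\<And>v. 0 \<le> g v"
    using assms unfolding cross_cone_def by blast
  then show ?thesis
    using sum_pos2[OF finite_cross_vertices, of v k s g] by (simp add: order_less_le)
qed

lemma scale1_in_cross_space:
  assumes "g \<in> cross_cone k s" shows "scale1 k s g \<in> topspace (cross_space k s)"
proof -
  have pos: "0 < sum g (cross_vertices k s)" by (rule cross_cone_sum_pos[OF assms])
  then have "sum (scale1 k s g) (cross_vertices k s) = 1"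
    unfolding scale1_def by (simp add: sum_divide_distrib[symmetric])
  moreover have "scale1 k s g v = 0 \<longleftrightarrow> g v = 0" "0 \<le> scale1 k s g v \<longleftrightarrow> 0 \<le> g v" for v
    using pos unfolding scale1_def by (simp_all add: zero_le_divide_iff)
  ultimately show ?thesis
    using assms unfolding in_cross_space_iff cross_cone_def by blast
qed

lemma cross_space_subset_cone: 
  assumes "f \<in> topspace (cross_space k s)" shows "f \<in> cross_cone k s"
proof -
  have sum: "sum f (cross_vertices k s) = 1" using assms unfolding in_cross_space_iff by blast
  have "\<exists>v. f v \<noteq> 0"
  proof (rule ccontr)
    assume "\<not> ?thesis"
    then show False using sum by simp
  qed
  then show ?thesis using assms unfolding in_cross_space_iff cross_cone_def by blast
qed

lemma scale1_id: "f \<in> topspace (cross_space k s) \<Longrightarrow> scale1 k s f = f"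
  by (simp add: in_cross_space_iff scale1_def)

lemma scale1_cmult: "0 < c \<Longrightarrow> scale1 k s (\<lambda>v. c * g v) = scale1 k s g"
  unfolding scale1_def by (simp add: sum_distrib_left[symmetric])

lemma continuous_map_scale1:
  assumes "\<And>v. continuous_map X euclideanreal (\<lambda>x. g x v)"
    and "\<And>x. x \<in> topspace X \<Longrightarrow> g x \<in> cross_cone k s"
  shows "continuous_map X (cross_space k s) (\<lambda>x. scale1 k s (g x))"
proof (rule continuous_map_into_realization)
  show "continuous_map X euclideanreal (\<lambda>x. scale1 k s (g x) v)" for v
    unfolding scale1_def using cross_cone_sum_pos[OF assms(2)]
    by (intro continuous_intros assms finite_cross_vertices) (simp add: order_less_imp_not_eq2)
qed (use assms(2) scale1_in_cross_space in auto)

definition scale2 :: "nat \<Rightarrow> (nat \<Rightarrow> real) \<Rightarrow> nat \<Rightarrow> real" where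
  "scale2 d y = (\<lambda>i. y i / sqrt (\<Sum>j\<le>d. y j ^ 2))"

definition sphere_cone :: "nat \<Rightarrow> (nat \<Rightarrow> real) set" where
  "sphere_cone d = {y. (\<forall>i>d. y i = 0) \<and> (\<exists>i. y i \<noteq> 0)}"

lemma in_nsphere_iff: "y \<in> topspace (nsphere d) \<longleftrightarrow> (\<Sum>i\<le>d. y i ^ 2) = 1 \<and> (\<forall>i>d. y i = 0)"
  by (simp add: nsphere)

lemma sphere_cone_norm_pos: assumes "y \<in> sphere_cone d" shows "0 < (\<Sum>j\<le>d. y j ^ 2)"
proof -
  obtain i where i: "y i \<noteq> 0" using assms unfolding sphere_cone_def by blast
  moreover have "i \<le> d"
  proof (rule ccontr)
    assume "\<not> i \<le> d"
    then show False using i assms unfolding sphere_cone_def by simp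
  qed
  ultimately show ?thesis using sum_pos2[of "{..d}" i "\<lambda>j. y j ^ 2"] by simp
qed

lemma scale2_in_nsphere: assumes "y \<in> sphere_cone d" shows "scale2 d y \<in> topspace (nsphere d)"
proof -
  have "(\<Sum>i\<le>d. scale2 d y i ^ 2) = 1"
    using sphere_cone_norm_pos[OF assms]
    unfolding scale2_def by (simp add: power_divide sum_divide_distrib[symmetric])
  moreover have "\<forall>i>d. scale2 d y i = 0" using assms unfolding sphere_cone_def scale2_def by simp
  ultimately show ?thesis unfolding in_nsphere_iff by blast
qed

lemma nsphere_subset_cone: assumes "y \<in> topspace (nsphere d)" shows "y \<in> sphere_cone d"
proof -
  have sum: "(\<Sum>i\<le>d. y i ^ 2) = 1" using assms unfolding in_nsphere_iff by blast
  have "\<exists>i. y i \<noteq> 0"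
  proof (rule ccontr)
    assume "\<not> ?thesis"
    then show False using sum by simp
  qed
  then show ?thesis using assms unfolding in_nsphere_iff sphere_cone_def by blast
qed

lemma scale2_id: "y \<in> topspace (nsphere d) \<Longrightarrow> scale2 d y = y"
  by (simp add: in_nsphere_iff scale2_def)

lemma continuous_map_scale2:
  assumes "\<And>i. continuous_map X euclideanreal (\<lambda>x. g x i)"
    and "\<And>x. x \<in> topspace X \<Longrightarrow> g x \<in> sphere_cone d"
  shows "continuous_map X (nsphere d) (\<lambda>x. scale2 d (g x))"
proof -
  have "continuous_map X euclideanreal (\<lambda>x. scale2 d (g x) i)" for i
    unfolding scale2_def using sphere_cone_norm_pos[OF assms(2)]
    by (intro continuous_intros assms) (auto simp: order_less_imp_not_eq2)
  moreover have "scale2 d (g x) \<in> {x. (\<Sum>i\<le>d. x i ^ 2) = 1 \<and> (\<forall>i>d. x i = 0)}" if "x \<in> topspace X" for x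
    using scale2_in_nsphere[OF assms(2)[OF that]] by (simp add: in_nsphere_iff)
  ultimately show ?thesis
    unfolding nsphere by (intro continuous_map_into_subtopology) (auto simp: continuous_map_componentwise_UNIV)
qed

lemma in_wedge_iff:
  "w \<in> topspace (wedge_of_spheres s d) \<longleftrightarrow>
     (\<forall>j<s. w j \<in> topspace (nsphere d)) \<and> w \<in> extensional {..<s} \<and>
     (\<forall>i<s. \<forall>j<s. i \<noteq> j \<longrightarrow> w i = sphere_base \<or> w j = sphere_base)"
  by (auto simp: wedge_of_spheres_def PiE_iff)

lemma continuous_map_into_wedge:
  assumes "\<And>j. j < s \<Longrightarrow> continuous_map X (nsphere d) (\<lambda>x. g x j)"
    and "\<And>x i j. x \<in> topspace X \<Longrightarrow> i < s \<Longrightarrow> j < s \<Longrightarrow> i \<noteq> j \<Longrightarrow> g x i = sphere_base \<or> g x j = sphere_base"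
  shows "continuous_map X (wedge_of_spheres s d) (\<lambda>x. \<lambda>j\<in>{..<s}. g x j)"
  unfolding wedge_of_spheres_def
proof (rule continuous_map_into_subtopology)
  show "continuous_map X (product_topology (\<lambda>_. nsphere d) {..<s}) (\<lambda>x. \<lambda>j\<in>{..<s}. g x j)"
    using assms(1) by (auto simp: continuous_map_componentwise)
qed (use assms(2) in auto)

lemma continuous_map_wedge_coordinate:
  assumes "j < s" shows "continuous_map (wedge_of_spheres s d) euclideanreal (\<lambda>w. w j i)"
proof -
  have "continuous_map (wedge_of_spheres s d) (nsphere d) (\<lambda>w. w j)"
    unfolding wedge_of_spheres_def using assms
    by (intro continuous_map_from_subtopology continuous_map_product_projection) auto
  from continuous_map_compose[OF this continuous_map_nsphere_projection]
  show ?thesis by (simp add: o_def)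
qed

text \<open>
  At most one coordinate differs from the base point, and any \<open>j\<close> will do if none does.
\<close>

lemma wedge_point_cases:
  assumes "0 < s" "w \<in> topspace (wedge_of_spheres s d)"
  obtains j where "j < s" "w j \<in> topspace (nsphere d)" "\<And>i. i < s \<Longrightarrow> i \<noteq> j \<Longrightarrow> w i = sphere_base"
proof (cases "\<exists>j<s. w j \<noteq> sphere_base")
  case True
  then obtain j where "j < s" "w j \<noteq> sphere_base" by blast
  with assms show ?thesis unfolding in_wedge_iff by (intro that[of j]) blast+
next
  case False
  with assms show ?thesis unfolding in_wedge_iff by (intro that[of 0]) blast+
qed

lemma nsphere_homeomorphic_wedge: "nsphere d homeomorphic_space wedge_of_spheres 1 d"
proof -
  have "continuous_map (nsphere d) (wedge_of_spheres 1 d) (\<lambda>y. \<lambda>j\<in>{..<1}. y)"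
    by (rule continuous_map_into_wedge) auto
  moreover have "continuous_map (wedge_of_spheres 1 d) (nsphere d) (\<lambda>w. w 0)"
    unfolding wedge_of_spheres_def
    by (intro continuous_map_from_subtopology continuous_map_product_projection) auto
  moreover have "(\<lambda>j\<in>{..<1}. w 0) = w" if "w \<in> topspace (wedge_of_spheres 1 d)" for w
    using that by (auto simp: in_wedge_iff extensional_def)
  ultimately show ?thesis
    unfolding homeomorphic_space_def homeomorphic_maps_def
    by (intro exI[of _ "\<lambda>y. \<lambda>j\<in>{..<1}. y"] exI[of _ "\<lambda>w. w 0"]) auto
qed

section \<open>Collapsing one of the cones\<close>

text \<open>
  Collapsing the cone with apex \<open>Apex 0\<close> to a point turns the other \<open>s\<close> cones, which are balls
  with a common boundary, into \<open>s\<close> spheres with a common point. To get a homotopy inverse,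
  the spheres are mapped back so that the hemispheres around the base point cover the cone over
  \<open>Apex 0\<close>, and the opposite ones the other cones. Both maps are given by unnormalized
  coordinates, and the homotopies to the identities are straight lines followed by normalization;
  the work consists in seeing that the lines avoid the origin.

  On the cone with apex \<open>Apex (Suc j)\<close>, at height \<open>t\<close>, the map to the \<open>j\<close>-th sphere is the direction
  of \<open>(1 - 2 t, t x)\<close>. The apex, with \<open>t = 1\<close> and \<open>x = 0\<close>, goes to the antipode of the base point,
  and everything with \<open>t = 0\<close> goes to the base point. At \<open>t = 1/2\<close>, where the first coordinate
  vanishes, \<open>x\<close> does not.
\<close>

definition collapse_raw :: "nat \<Rightarrow> (cross_vertex \<Rightarrow> real) \<Rightarrow> nat \<Rightarrow> nat \<Rightarrow> real" where
  "collapse_raw k f j = (\<lambda>i. if i = 0 then 1 - 2 * f (Apex (Suc j))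
     else if i \<le> k then f (Apex (Suc j)) * (f (Pos i) - f (Neg i)) else 0)"

definition collapse :: "nat \<Rightarrow> nat \<Rightarrow> (cross_vertex \<Rightarrow> real) \<Rightarrow> nat \<Rightarrow> nat \<Rightarrow> real" where
  "collapse k s f = (\<lambda>j\<in>{..<s}. scale2 k (collapse_raw k f j))"

text \<open>
  Only one of the spheres contributes to the sums, since the base point has no coordinates other
  than the \<open>0\<close>-th. That coordinate becomes the height in the cone over \<open>Apex 0\<close> where it is positive,
  and the height in another cone where it is negative. The product picks out the factor of the
  sphere in question, all the others being \<open>1\<close> at the base point.
\<close>

fun expand_raw :: "nat \<Rightarrow> nat \<Rightarrow> (nat \<Rightarrow> nat \<Rightarrow> real) \<Rightarrow> cross_vertex \<Rightarrow> real" where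
  "expand_raw k s w (Pos i) = (if 1 \<le> i \<and> i \<le> k then max 0 (\<Sum>j<s. w j i) else 0)"
| "expand_raw k s w (Neg i) = (if 1 \<le> i \<and> i \<le> k then max 0 (- (\<Sum>j<s. w j i)) else 0)"
| "expand_raw k s w (Apex 0) = (\<Prod>j<s. max 0 (w j 0))"
| "expand_raw k s w (Apex (Suc j)) = (if j < s then max 0 (- w j 0) else 0)"

definition expand :: "nat \<Rightarrow> nat \<Rightarrow> (nat \<Rightarrow> nat \<Rightarrow> real) \<Rightarrow> cross_vertex \<Rightarrow> real" where
  "expand k s w = scale1 k s (expand_raw k s w)"

fun expand_sphere :: "nat \<Rightarrow> nat \<Rightarrow> (nat \<Rightarrow> real) \<Rightarrow> cross_vertex \<Rightarrow> real" where
  "expand_sphere k j y (Pos i) = (if 1 \<le> i \<and> i \<le> k then max 0 (y i) else 0)"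
| "expand_sphere k j y (Neg i) = (if 1 \<le> i \<and> i \<le> k then max 0 (- y i) else 0)"
| "expand_sphere k j y (Apex 0) = max 0 (y 0)"
| "expand_sphere k j y (Apex (Suc i)) = (if i = j then max 0 (- y 0) else 0)"

lemma expand_raw_on_sphere:
  assumes j: "j < s" and base: "\<And>i. i < s \<Longrightarrow> i \<noteq> j \<Longrightarrow> w i = sphere_base"
  shows "expand_raw k s w = expand_sphere k j (w j)"
proof
  fix v
  have sum: "(\<Sum>l<s. w l i) = w j i" if "1 \<le> i" for i
  proof -
    have "(\<Sum>l<s. w l i) = w j i + (\<Sum>l\<in>{..<s}-{j}. w l i)" using j by (simp add: sum.remove)
    also have "(\<Sum>l\<in>{..<s}-{j}. w l i) = 0" using base that by (intro sum.neutral) (simp add: sphere_base_def)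
    finally show ?thesis by simp
  qed
  have prod: "(\<Prod>l<s. max 0 (w l 0)) = max 0 (w j 0)"
  proof -
    have "(\<Prod>l<s. max 0 (w l 0)) = max 0 (w j 0) * (\<Prod>l\<in>{..<s}-{j}. max 0 (w l 0))"
      using j by (simp add: prod.remove)
    also have "(\<Prod>l\<in>{..<s}-{j}. max 0 (w l 0)) = 1" using base by (intro prod.neutral) (simp add: sphere_base_def)
    finally show ?thesis by simp
  qed
  show "expand_raw k s w v = expand_sphere k j (w j) v"
  proof (cases v)
    case (Apex n)
    then show ?thesis using prod base j by (cases n) (auto simp: sphere_base_def)
  qed (auto simp: sum)
qed

lemma expand_sphere_in_cone:
  assumes j: "j < s" and y: "y \<in> sphere_cone k"
  shows "expand_sphere k j y \<in> cross_cone k s"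
proof -
  let ?g = "expand_sphere k j y"
  have nonneg: "0 \<le> ?g v" for v
    by (cases "(k, j, y, v)" rule: expand_sphere.cases) auto
  have supp: "?g v = 0" if "v \<notin> cross_vertices k s" for v
    using that j by (cases "(k, j, y, v)" rule: expand_sphere.cases) (auto simp: cross_vertices_def)
  have apex: "?g (Apex i) = 0 \<or> ?g (Apex l) = 0" if "i \<noteq> l" for i l
    using that by (cases i; cases l) auto
  have "\<exists>v. ?g v \<noteq> 0"
  proof -
    obtain i where i: "y i \<noteq> 0" and out: "\<forall>i>k. y i = 0" using y by (auto simp: sphere_cone_def)
    then have ik: "i \<le> k" by (meson not_le)
    consider "i = 0" "y i > 0" | "i = 0" "y i < 0" | "1 \<le> i" "y i > 0" | "1 \<le> i" "y i < 0"
      using i by linarith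
    then show ?thesis
    proof cases
      case 1 then show ?thesis by (intro exI[of _ "Apex 0"]) simp
    next
      case 2 then show ?thesis by (intro exI[of _ "Apex (Suc j)"]) simp
    next
      case 3 then show ?thesis using ik by (intro exI[of _ "Pos i"]) simp
    next
      case 4 then show ?thesis using ik by (intro exI[of _ "Neg i"]) simp
    qed
  qed
  moreover have "?g (Pos i) = 0 \<or> ?g (Neg i) = 0" for i by auto
  ultimately show ?thesis using nonneg supp apex unfolding cross_cone_def by blast
qed

lemma expand_raw_in_cone:
  assumes s: "0 < s" and w: "w \<in> topspace (wedge_of_spheres s k)"
  shows "expand_raw k s w \<in> cross_cone k s"
proof -
  obtain j where j: "j < s" "w j \<in> topspace (nsphere k)" "\<And>i. i < s \<Longrightarrow> i \<noteq> j \<Longrightarrow> w i = sphere_base"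
    using wedge_point_cases[OF s w] by blast
  show ?thesis
    using expand_sphere_in_cone[OF j(1) nsphere_subset_cone[OF j(2)]] expand_raw_on_sphere[OF j(1,3)] by simp
qed

lemma continuous_map_expand_raw:
  "continuous_map (wedge_of_spheres s k) euclideanreal (\<lambda>w. expand_raw k s w v)"
proof (cases v)
  case (Apex n)
  then show ?thesis
    by (cases n) (auto intro!: continuous_intros continuous_map_wedge_coordinate)
next
  case (Pos i)
  then show ?thesis
    by (cases "1 \<le> i \<and> i \<le> k") (auto intro!: continuous_intros continuous_map_wedge_coordinate)
next
  case (Neg i)
  then show ?thesis
    by (cases "1 \<le> i \<and> i \<le> k") (auto simp del: continuous_map_minus_eq intro!: continuous_intros continuous_map_wedge_coordinate)
qed

lemma continuous_map_expand:
  "0 < s \<Longrightarrow> continuous_map (wedge_of_spheres s k) (cross_space k s) (expand k s)"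
  unfolding expand_def by (intro continuous_map_scale1 continuous_map_expand_raw expand_raw_in_cone)

lemma cross_space_le1: assumes f: "f \<in> topspace (cross_space k s)" shows "0 \<le> f v" "f v \<le> 1"
proof -
  have nonneg: "\<And>v. 0 \<le> f v" and out: "\<And>v. v \<notin> cross_vertices k s \<Longrightarrow> f v = 0"
    and sum: "sum f (cross_vertices k s) = 1"
    using f unfolding in_cross_space_iff by blast+
  show "0 \<le> f v" by (rule nonneg)
  show "f v \<le> 1"
  proof (cases "v \<in> cross_vertices k s")
    case True
    then have "f v \<le> sum f (cross_vertices k s)"
      using nonneg by (intro member_le_sum finite_cross_vertices)
    then show ?thesis using sum by simp
  qed (simp add: out)
qed

lemma cross_space_off_apex:
  assumes f: "f \<in> topspace (cross_space k s)" and lt: "0 < f (Apex n)" "f (Apex n) < 1"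
  obtains i where "1 \<le> i" "i \<le> k" "f (Pos i) \<noteq> 0 \<or> f (Neg i) \<noteq> 0"
proof -
  have out: "\<And>v. v \<notin> cross_vertices k s \<Longrightarrow> f v = 0"
    and apex: "\<And>i j. i \<noteq> j \<Longrightarrow> f (Apex i) = 0 \<or> f (Apex j) = 0"
    and sum: "sum f (cross_vertices k s) = 1"
    using f unfolding in_cross_space_iff by blast+
  have "\<exists>v. v \<noteq> Apex n \<and> f v \<noteq> 0"
  proof (rule ccontr)
    assume no: "\<not> ?thesis"
    have "Apex n \<in> cross_vertices k s" using out lt(1) by force
    then have "sum f (cross_vertices k s) = f (Apex n) + sum f (cross_vertices k s - {Apex n})"
      by (simp add: sum.remove finite_cross_vertices)
    also have "sum f (cross_vertices k s - {Apex n}) = 0" using no by (intro sum.neutral) auto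
    finally show False using sum lt(2) by simp
  qed
  then obtain v where v: "v \<noteq> Apex n" "f v \<noteq> 0" by blast
  have "v \<in> cross_vertices k s" using out v(2) by blast
  moreover have "v \<noteq> Apex m" for m using apex[of m n] v lt(1) by auto
  ultimately obtain i where "i \<in> {1..k}" "v = Pos i \<or> v = Neg i"
    unfolding cross_vertices_def by blast
  then show ?thesis using v that[of i] by auto
qed

lemma collapse_raw_in_cone:
  assumes f: "f \<in> topspace (cross_space k s)"
  shows "collapse_raw k f j \<in> sphere_cone k"
proof -
  have "\<exists>i. collapse_raw k f j i \<noteq> 0"
  proof (cases "f (Apex (Suc j)) = 1/2")
    case True
    then obtain i where i: "1 \<le> i" "i \<le> k" "f (Pos i) \<noteq> 0 \<or> f (Neg i) \<noteq> 0"
      using cross_space_off_apex[OF f, of "Suc j"] by auto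
    moreover have "f (Pos i) = 0 \<or> f (Neg i) = 0" using f unfolding in_cross_space_iff by blast
    ultimately show ?thesis using True by (intro exI[of _ i]) (auto simp: collapse_raw_def)
  qed (intro exI[of _ 0], simp add: collapse_raw_def)
  then show ?thesis by (simp add: sphere_cone_def collapse_raw_def)
qed

lemma collapse_raw_base:
  "f (Apex (Suc j)) = 0 \<Longrightarrow> collapse_raw k f j = sphere_base"
  by (auto simp: collapse_raw_def sphere_base_def)

lemma scale2_sphere_base: "scale2 d sphere_base = sphere_base"
  by (rule scale2_id[OF sphere_base_in_nsphere])

lemma continuous_map_collapse_raw:
  assumes "continuous_map X (cross_space k s) g"
  shows "continuous_map X euclideanreal (\<lambda>x. collapse_raw k (g x) j i)"
proof -
  have "continuous_map X euclideanreal (\<lambda>x. g x v)" for v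
    using continuous_map_compose[OF assms continuous_map_coordinate] by (simp add: o_def)
  then show ?thesis unfolding collapse_raw_def
    by (cases "i = 0"; cases "i \<le> k") (auto intro!: continuous_intros)
qed

lemma continuous_map_collapse:
  "continuous_map (cross_space k s) (wedge_of_spheres s k) (collapse k s)"
  unfolding collapse_def
proof (rule continuous_map_into_wedge)
  show "continuous_map (cross_space k s) (nsphere k) (\<lambda>f. scale2 k (collapse_raw k f j))" for j
    by (intro continuous_map_scale2 continuous_map_collapse_raw[of _ k s] collapse_raw_in_cone) auto
  fix f i j assume "f \<in> topspace (cross_space k s)" "i \<noteq> (j::nat)"
  then have "f (Apex (Suc i)) = 0 \<or> f (Apex (Suc j)) = 0" unfolding in_cross_space_iff by blast
  then show "scale2 k (collapse_raw k f i) = sphere_base \<or> scale2 k (collapse_raw k f j) = sphere_base"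
    using collapse_raw_base scale2_sphere_base by metis
qed

text \<open>
  On the sphere in question the segment from \<open>y\<close> to its image has the coordinates
  \<open>((1 - t) + t c) y\<^sub>i\<close> with \<open>c \<ge> 0\<close> for \<open>i > 0\<close>. They vanish only if \<open>y\<close> is one of the two poles,
  whose directions are fixed, or if \<open>t = 1\<close> and \<open>y\<close> lies in the hemisphere that is sent to the base
  point. In both cases the \<open>0\<close>-th coordinate is not zero.
\<close>

lemma homotopic_collapse_expand:
  assumes s: "0 < s"
  shows "homotopic_with (\<lambda>_. True) (wedge_of_spheres s k) (wedge_of_spheres s k) id (collapse k s \<circ> expand k s)"
proof -
  let ?W = "wedge_of_spheres s k" and ?I = "top_of_set {0..1::real}"
  let ?c = "\<lambda>w j i. collapse_raw k (expand k s w) j i"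
  let ?q = "\<lambda>t w j i. (1 - t) * w j i + t * ?c w j i"
  \<comment> \<open>The homotopy fixes the base point, so it stays within the wedge.\<close>
  have base: "?q t w j = sphere_base"
    if w: "w \<in> topspace ?W" and j: "j < s" "w j = sphere_base" for t w j
  proof -
    have "expand_raw k s w (Apex (Suc j)) = 0" using j by (simp add: sphere_base_def)
    then have "?c w j = sphere_base"
      by (intro collapse_raw_base) (simp add: expand_def scale1_def)
    then show ?thesis using j(2) by (auto simp: algebra_simps)
  qed
  have cone: "?q t w j \<in> sphere_cone k"
    if w: "w \<in> topspace ?W" and j: "j < s" and t: "0 \<le> t" "t \<le> 1" for t w j
  proof (cases "w j = sphere_base")
    case True
    then show ?thesis using base[OF w j] nsphere_subset_cone[OF sphere_base_in_nsphere] by simp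
  next
    case False
    let ?y = "w j"
    let ?N = "sum (expand_raw k s w) (cross_vertices k s)"
    have y: "?y \<in> topspace (nsphere k)" using w j unfolding in_wedge_iff by blast
    have raw: "expand_raw k s w = expand_sphere k j ?y"
      using w j False unfolding in_wedge_iff by (intro expand_raw_on_sphere) blast+
    have N: "0 < ?N" by (rule cross_cone_sum_pos[OF expand_raw_in_cone[OF s w]])
    have c0: "?c w j 0 = 1 - 2 * (max 0 (- ?y 0) / ?N)"
      by (simp add: collapse_raw_def expand_def scale1_def raw)
    have ci: "?c w j i = (max 0 (- ?y 0) / ?N) * (?y i / ?N)" if "1 \<le> i" "i \<le> k" for i
    proof -
      have "max 0 (?y i) / ?N - max 0 (- ?y i) / ?N = ?y i / ?N"
        by (simp add: max_def diff_divide_distrib[symmetric])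
      then show ?thesis using that by (simp add: collapse_raw_def expand_def scale1_def raw)
    qed
    let ?a = "max 0 (- ?y 0) / ?N"
    have a: "0 \<le> ?a" using N by simp
    have "\<exists>i. ?q t w j i \<noteq> 0"
    proof (cases "\<exists>i. 1 \<le> i \<and> i \<le> k \<and> ?y i \<noteq> 0")
      case True
      then obtain i where i: "1 \<le> i" "i \<le> k" "?y i \<noteq> 0" by blast
      have q: "?q t w j i = ((1 - t) + t * (?a / ?N)) * ?y i"
        unfolding ci[OF i(1,2)] by (simp add: algebra_simps)
      have "0 \<le> t * (?a / ?N)" using a N t by simp
      show ?thesis
      proof (cases "(1 - t) + t * (?a / ?N) = 0")
        case True
        then have "t = 1" using \<open>0 \<le> t * (?a / ?N)\<close> t by linarith
        then have "?a = 0" using True N by simp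
        then show ?thesis using \<open>t = 1\<close> by (intro exI[of _ 0]) (simp only: c0, simp)
      next
        case False
        then show ?thesis using q i(3) by (intro exI[of _ i]) simp
      qed
    next
      case False
      then have zero: "?y i = 0" if "i \<noteq> 0" for i
        using y that unfolding in_nsphere_iff by (metis One_nat_def Suc_leI neq0_conv not_le)
      have "?N = (\<Sum>i=1..k. expand_sphere k j ?y (Pos i) + expand_sphere k j ?y (Neg i)) + expand_sphere k j ?y (Apex 0)
          + (\<Sum>l<s. expand_sphere k j ?y (Apex (Suc l)))"
        unfolding raw sum_cross_vertices ..
      also have "\<dots> = max 0 (?y 0) + max 0 (- ?y 0)" using j zero by simp
      finally have N': "?N = \<bar>?y 0\<bar>" by simp
      have q0: "?q t w j 0 = (1 - t) * ?y 0 + t * (1 - 2 * ?a)" unfolding c0 ..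
      show ?thesis
      proof (cases "0 < ?y 0")
        case True
        then have "?q t w j 0 = (1 - t) * ?y 0 + t" unfolding q0 by simp
        moreover have "\<dots> > 0" using True t by (smt (verit) mult_nonneg_nonneg mult_pos_pos)
        ultimately show ?thesis by (intro exI[of _ 0]) linarith
      next
        case False
        then have neg: "?y 0 < 0" using N N' by linarith
        then have "?a = 1" unfolding N' by simp
        then have "?q t w j 0 = (1 - t) * ?y 0 - t" unfolding q0 by simp
        moreover have "\<dots> < 0" using neg t by (smt (verit) mult_nonneg_nonpos mult_pos_neg)
        ultimately show ?thesis by (intro exI[of _ 0]) linarith
      qed
    qed
    moreover have "?q t w j i = 0" if "i > k" for i
      using y that by (simp add: in_nsphere_iff collapse_raw_def)
    ultimately show ?thesis unfolding sphere_cone_def by blast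
  qed
  let ?T = "prod_topology ?I ?W"
  have snd: "continuous_map ?T ?W snd" by (rule continuous_map_snd)
  have "continuous_map ?T ?W (\<lambda>z. \<lambda>j\<in>{..<s}. scale2 k (?q (fst z) (snd z) j))"
  proof (rule continuous_map_into_wedge)
    fix j assume j: "j < s"
    have "continuous_map ?T euclideanreal (\<lambda>z. snd z j i)" for i
      using continuous_map_compose[OF snd continuous_map_wedge_coordinate[OF j]] by (simp add: o_def)
    moreover have "continuous_map ?T (cross_space k s) (\<lambda>z. expand k s (snd z))"
      using continuous_map_compose[OF snd continuous_map_expand[OF s]] by (simp add: o_def)
    ultimately show "continuous_map ?T (nsphere k) (\<lambda>z. scale2 k (?q (fst z) (snd z) j))"
      using j by (intro continuous_map_scale2 continuous_intros continuous_map_fst_interval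
          continuous_map_collapse_raw cone) auto
  next
    fix z i j assume z: "z \<in> topspace ?T" and ij: "i < s" "j < s" "i \<noteq> j"
    then have w: "snd z \<in> topspace ?W" by auto
    then have "snd z i = sphere_base \<or> snd z j = sphere_base" using ij unfolding in_wedge_iff by blast
    then show "scale2 k (?q (fst z) (snd z) i) = sphere_base \<or> scale2 k (?q (fst z) (snd z) j) = sphere_base"
      using base[OF w] ij scale2_sphere_base by metis
  qed
  moreover have "(\<lambda>j\<in>{..<s}. scale2 k (?q 0 w j)) = id w" if "w \<in> topspace ?W" for w
    using that by (auto simp: in_wedge_iff scale2_id extensional_def)
  moreover have "(\<lambda>j\<in>{..<s}. scale2 k (?q 1 w j)) = (collapse k s \<circ> expand k s) w" for w
    by (simp add: collapse_def)
  ultimately show ?thesis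
    by (subst homotopic_with) (force intro!: exI[of _ "\<lambda>z. \<lambda>j\<in>{..<s}. scale2 k (?q (fst z) (snd z) j)"])+
qed

text \<open>
  A straight line from the identity, at \<open>t = 0\<close>, to an unnormalized form of the composition of
  \<open>collapse\<close> with \<open>expand\<close>, at \<open>t = 1\<close>. For a point in the cone over \<open>Apex (Suc j)\<close> the heights over
  \<open>Apex 0\<close> and \<open>Apex (Suc j)\<close> are the negative and the positive part of one real parameter, which
  moves from \<open>T - f (Apex 0)\<close> to \<open>2 T - 1\<close>.
\<close>

fun spread :: "nat \<Rightarrow> real \<Rightarrow> (cross_vertex \<Rightarrow> real) \<Rightarrow> cross_vertex \<Rightarrow> real" where
  "spread s t f (Apex 0) = (let T = \<Sum>j<s. f (Apex (Suc j)) in max 0 ((1 - t) * (f (Apex 0) - T) + t * (1 - 2 * T)))"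
| "spread s t f (Apex (Suc j)) = (if j < s then max 0 ((1 - t) * f (Apex (Suc j)) + t * (2 * f (Apex (Suc j)) - 1)) else 0)"
| "spread s t f (Pos i) = ((1 - t) + t * (\<Sum>j<s. f (Apex (Suc j)))) * f (Pos i)"
| "spread s t f (Neg i) = ((1 - t) + t * (\<Sum>j<s. f (Apex (Suc j)))) * f (Neg i)"

text \<open>
  Every point lies in the cone over \<open>Apex 0\<close> or over some \<open>Apex (Suc j)\<close>; in the first case \<open>j\<close> is
  arbitrary.
\<close>

lemma cross_space_cone:
  assumes s: "0 < s" and f: "f \<in> topspace (cross_space k s)"
  obtains j where "j < s" "\<And>i. i \<noteq> j \<Longrightarrow> f (Apex (Suc i)) = 0" "(\<Sum>i<s. f (Apex (Suc i))) = f (Apex (Suc j))"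
    "f (Apex 0) = 0 \<or> f (Apex (Suc j)) = 0"
proof -
  have apex: "\<And>i j. i \<noteq> j \<Longrightarrow> f (Apex i) = 0 \<or> f (Apex j) = 0"
    and out: "\<And>v. v \<notin> cross_vertices k s \<Longrightarrow> f v = 0"
    using f unfolding in_cross_space_iff by blast+
  have "\<exists>j<s. \<forall>i. i \<noteq> j \<longrightarrow> f (Apex (Suc i)) = 0"
  proof (cases "\<exists>j. f (Apex (Suc j)) \<noteq> 0")
    case True
    then obtain j where j: "f (Apex (Suc j)) \<noteq> 0" by blast
    then have "Apex (Suc j) \<in> cross_vertices k s" using out by blast
    then have "j < s" by (auto simp: cross_vertices_def)
    moreover have "f (Apex (Suc i)) = 0" if "i \<noteq> j" for i using apex[of "Suc i" "Suc j"] j that by simp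
    ultimately show ?thesis by blast
  qed (use s in blast)
  then obtain j where j: "j < s" "\<And>i. i \<noteq> j \<Longrightarrow> f (Apex (Suc i)) = 0" by blast
  moreover have "(\<Sum>i<s. f (Apex (Suc i))) = f (Apex (Suc j))"
  proof -
    have "(\<Sum>i<s. f (Apex (Suc i))) = f (Apex (Suc j)) + (\<Sum>i\<in>{..<s}-{j}. f (Apex (Suc i)))"
      using j(1) by (simp add: sum.remove)
    also have "(\<Sum>i\<in>{..<s}-{j}. f (Apex (Suc i))) = 0" using j(2) by (intro sum.neutral) auto
    finally show ?thesis by simp
  qed
  moreover have "f (Apex 0) = 0 \<or> f (Apex (Suc j)) = 0" using apex[of 0 "Suc j"] by simp
  ultimately show ?thesis using that by blast
qed

lemma spread_in_cone:
  assumes s: "0 < s" and f: "f \<in> topspace (cross_space k s)" and t: "0 \<le> t" "t \<le> 1"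
  shows "spread s t f \<in> cross_cone k s"
proof -
  obtain j where j: "j < s" and zero: "\<And>i. i \<noteq> j \<Longrightarrow> f (Apex (Suc i)) = 0"
    and T: "(\<Sum>i<s. f (Apex (Suc i))) = f (Apex (Suc j))" and z0: "f (Apex 0) = 0 \<or> f (Apex (Suc j)) = 0"
    using cross_space_cone[OF s f] by blast
  let ?g = "spread s t f" and ?t = "f (Apex (Suc j))"
  have f0: "0 \<le> f v" "f v \<le> 1" for v by (rule cross_space_le1[OF f])+
  have out: "\<And>v. v \<notin> cross_vertices k s \<Longrightarrow> f v = 0" and pn: "\<And>i. f (Pos i) = 0 \<or> f (Neg i) = 0"
    using f unfolding in_cross_space_iff by blast+
  have coeff: "0 \<le> (1 - t) + t * ?t" using t f0 by simp
  have nonneg: "0 \<le> ?g v" for v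
    by (cases "(s, t, f, v)" rule: spread.cases) (use coeff f0 in \<open>auto simp: T Let_def\<close>)
  have supp: "?g v = 0" if "v \<notin> cross_vertices k s" for v
    by (cases "(s, t, f, v)" rule: spread.cases) (use that out[OF that] in \<open>auto simp: T cross_vertices_def\<close>)
  have other: "?g (Apex (Suc i)) = 0" if "i \<noteq> j" for i
    using zero[OF that] t by simp
  have top: "?g (Apex 0) = 0 \<or> ?g (Apex (Suc j)) = 0"
  proof (cases "?t = 0")
    case True
    then show ?thesis using t by simp
  next
    case False
    then have "f (Apex 0) = 0" using z0 by blast
    then show ?thesis by (auto simp: T Let_def max_def algebra_simps)
  qed
  have apex: "?g (Apex i) = 0 \<or> ?g (Apex l) = 0" if "i \<noteq> l" for i l
    using that other top by (cases i; cases l) (metis One_nat_def)+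
  have "\<exists>v. ?g v \<noteq> 0"
  proof (cases "?t = 1")
    case True
    then show ?thesis using j by (intro exI[of _ "Apex (Suc j)"]) simp
  next
    case ne1: False
    show ?thesis
    proof (cases "?t = 0")
      case False
      then have "0 < ?t" "?t < 1" using f0[of "Apex (Suc j)"] ne1 by linarith+
      then obtain i where i: "f (Pos i) \<noteq> 0 \<or> f (Neg i) \<noteq> 0"
        using cross_space_off_apex[OF f] by metis
      have "(1 - t) + t * ?t \<noteq> 0"
      proof (cases "t = 0")
        case False
        then have "0 < t * ?t" using \<open>0 < ?t\<close> t by simp
        then show ?thesis using t by linarith
      qed simp
      then show ?thesis using i by (auto simp: T intro: exI[of _ "Pos i"] exI[of _ "Neg i"])
    next
      case t0: True
      show ?thesis
      proof (cases "t = 1")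
        case True
        then show ?thesis using t0 T by (intro exI[of _ "Apex 0"]) simp
      next
        case False
        obtain v where v: "f v \<noteq> 0" using cross_space_subset_cone[OF f] unfolding cross_cone_def by blast
        show ?thesis
        proof (cases v)
          case (Apex n)
          then have "n = 0" using v zero t0 by (cases n) metis+
          then have "0 < (1 - t) * f (Apex 0)" using v Apex f0[of v] t False by simp
          then have "0 < (1 - t) * f (Apex 0) + t" using t by linarith
          then show ?thesis using T t0 by (intro exI[of _ "Apex 0"]) simp
        next
          case (Pos i)
          then show ?thesis using v False T t0 by (intro exI[of _ v]) simp
        next
          case (Neg i)
          then show ?thesis using v False T t0 by (intro exI[of _ v]) simp
        qed
      qed
    qed
  qed
  moreover have "?g (Pos i) = 0 \<or> ?g (Neg i) = 0" for i using pn[of i] by auto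
  ultimately show ?thesis using nonneg supp apex unfolding cross_cone_def by blast
qed

lemma spread_0:
  assumes s: "0 < s" and f: "f \<in> topspace (cross_space k s)"
  shows "spread s 0 f = f"
proof
  fix v
  obtain j where j: "j < s" and zero: "\<And>i. i \<noteq> j \<Longrightarrow> f (Apex (Suc i)) = 0"
    and T: "(\<Sum>i<s. f (Apex (Suc i))) = f (Apex (Suc j))" and z0: "f (Apex 0) = 0 \<or> f (Apex (Suc j)) = 0"
    using cross_space_cone[OF s f] by blast
  have f0: "0 \<le> f v" for v by (rule cross_space_le1[OF f])
  show "spread s 0 f v = f v"
  proof (cases "(s, 0::real, f, v)" rule: spread.cases)
    case (1 s t f)
    then show ?thesis using z0 f0[of "Apex 0"] f0[of "Apex (Suc j)"] T by auto
  next
    case (2 s t f i)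
    then show ?thesis using f0[of "Apex (Suc i)"] zero[of i] j by auto
  qed auto
qed

text \<open>
  The positive factor by which the two unnormalized maps differ is the Euclidean norm \<open>R\<close> that
  \<open>collapse\<close> divides by; it disappears in the normalization.
\<close>

lemma expand_collapse:
  assumes s: "0 < s" and f: "f \<in> topspace (cross_space k s)"
  shows "expand k s (collapse k s f) = scale1 k s (spread s 1 f)"
proof -
  obtain j where j: "j < s" and zero: "\<And>i. i \<noteq> j \<Longrightarrow> f (Apex (Suc i)) = 0"
    and T: "(\<Sum>i<s. f (Apex (Suc i))) = f (Apex (Suc j))"
    using cross_space_cone[OF s f] by blast
  have f0: "0 \<le> f v" for v by (rule cross_space_le1[OF f])
  have pn: "\<And>i. f (Pos i) = 0 \<or> f (Neg i) = 0" and out: "\<And>v. v \<notin> cross_vertices k s \<Longrightarrow> f v = 0"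
    using f unfolding in_cross_space_iff by blast+
  let ?t = "f (Apex (Suc j))"
  define y where "y = collapse_raw k f j"
  define R where "R = sqrt (\<Sum>i\<le>k. y i ^ 2)"
  have R: "0 < R"
    unfolding R_def y_def using sphere_cone_norm_pos[OF collapse_raw_in_cone[OF f]] by simp
  have cj: "collapse k s f j = (\<lambda>i. y i / R)"
    using j by (simp add: collapse_def scale2_def y_def R_def)
  have "collapse k s f i = sphere_base" if "i < s" "i \<noteq> j" for i
    using that zero by (simp add: collapse_def collapse_raw_base scale2_sphere_base)
  then have "expand_raw k s (collapse k s f) = expand_sphere k j (\<lambda>i. y i / R)"
    unfolding cj[symmetric] by (intro expand_raw_on_sphere j)
  also have "\<dots> = (\<lambda>v. (1 / R) * spread s 1 f v)"
  proof
    fix v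
    have mx: "max 0 (x / R) = max 0 x / R" for x
      using R by (simp add: max_def divide_le_0_iff zero_le_divide_iff)
    have mx': "max 0 (- (x / R)) = max 0 (- x) / R" for x
      using mx[of "- x"] by simp
    show "expand_sphere k j (\<lambda>i. y i / R) v = (1 / R) * spread s 1 f v"
    proof (cases v)
      case (Pos i)
      have 1: "max 0 (?t * (f (Pos i) - f (Neg i))) = ?t * f (Pos i)"
        using pn[of i] f0[of "Pos i"] f0[of "Neg i"] f0[of "Apex (Suc j)"] 
        by (cases "f (Pos i) = 0") (simp_all add: max_absorb1 mult_nonneg_nonneg max_absorb2)
      have 2: "f (Pos i) = 0" if "\<not> (1 \<le> i \<and> i \<le> k)"
        using that by (intro out) (auto simp: cross_vertices_def)
      show ?thesis using Pos 1 2 T by (auto simp: mx y_def collapse_raw_def)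
    next
      case (Neg i)
      have 1: "max 0 (- (?t * (f (Pos i) - f (Neg i)))) = ?t * f (Neg i)"
        using pn[of i] f0[of "Pos i"] f0[of "Neg i"] f0[of "Apex (Suc j)"] 
        by (cases "f (Pos i) = 0") (simp_all add: max_absorb1 mult_nonneg_nonneg max_absorb2)
      have 2: "f (Neg i) = 0" if "\<not> (1 \<le> i \<and> i \<le> k)"
        using that by (intro out) (auto simp: cross_vertices_def)
      show ?thesis using Neg 1 2 T by (auto simp: mx' y_def collapse_raw_def)
    next
      case (Apex n)
      then show ?thesis using T zero j
        by (cases n) (auto simp: mx mx' y_def collapse_raw_def Let_def)
    qed
  qed
  finally show ?thesis unfolding expand_def using R by (simp add: scale1_cmult del: times_divide_eq_left)
qed

lemma homotopic_expand_collapse: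
  assumes s: "0 < s"
  shows "homotopic_with (\<lambda>_. True) (cross_space k s) (cross_space k s) id (expand k s \<circ> collapse k s)"
proof -
  let ?Y = "cross_space k s"
  let ?T = "prod_topology (top_of_set {0..1::real}) ?Y"
  have "continuous_map ?T ?Y (\<lambda>z. scale1 k s (spread s (fst z) (snd z)))"
  proof (rule continuous_map_scale1)
    fix v
    show "continuous_map ?T euclideanreal (\<lambda>z. spread s (fst z) (snd z) v)"
    proof (cases v)
      case (Apex n)
      show ?thesis
      proof (cases n)
        case 0
        then show ?thesis using Apex by (auto simp: Let_def intro!: continuous_intros continuous_map_fst_interval continuous_map_coordinate_snd)
      next
        case (Suc j)
        then show ?thesis using Apex by (cases "j < s") (auto intro!: continuous_intros continuous_map_fst_interval continuous_map_coordinate_snd)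
      qed
    qed (auto intro!: continuous_intros continuous_map_fst_interval continuous_map_coordinate_snd)
  qed (auto intro: spread_in_cone[OF s])
  then show ?thesis
    by (subst homotopic_with)
      (force intro!: exI[of _ "\<lambda>z. scale1 k s (spread s (fst z) (snd z))"] simp: spread_0[OF s] scale1_id expand_collapse[OF s])+
qed

lemma cross_space_homotopy_equivalent_wedge:
  assumes s: "0 < s"
  shows "cross_space k s homotopy_equivalent_space wedge_of_spheres s k"
  unfolding homotopy_equivalent_space_def
  using continuous_map_collapse continuous_map_expand[OF s]
    homotopic_collapse_expand[OF s] homotopic_expand_collapse[OF s] homotopic_with_sym
  by metis

section \<open>Transport to arbitrary vertex sets\<close>

lemma realization_image_homeomorphic:
  fixes e :: "'b \<Rightarrow> 'a"
  assumes V: "finite V" and inj: "inj_on e V" and K: "\<And>F. F \<in> K \<Longrightarrow> F \<subseteq> V"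
  shows "realization ((`) e ` K) homeomorphic_space realization K"
proof -
  let ?L = "(`) e ` K"
  let ?pull = "\<lambda>f p. if p \<in> V then f (e p) else (0::real)"
  let ?push = "\<lambda>g v. if v \<in> e ` V then g (inv_into V e v) else (0::real)"
  have fV: "finite (e ` V)" using V by simp
  have L: "F \<subseteq> e ` V" if "F \<in> ?L" for F using that K by blast
  have inv: "inv_into V e (e p) = p" if "p \<in> V" for p using inj that by simp
  have pull: "?pull f \<in> topspace (realization K)" if f: "f \<in> topspace (realization ?L)" for f
  proof -
    have f': "\<And>v. 0 \<le> f v" "{v. f v \<noteq> 0} \<in> ?L" "sum f (e ` V) = 1"
      using f in_realization_iff[OF fV L] by blast+
    obtain F where F: "F \<in> K" "{v. f v \<noteq> 0} = e ` F" using f'(2) by blast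
    have "p \<in> F \<longleftrightarrow> p \<in> V \<and> f (e p) \<noteq> 0" for p
    proof -
      have "f (e p) \<noteq> 0 \<longleftrightarrow> e p \<in> e ` F" using F(2) by blast
      then show ?thesis using K[OF F(1)] inj unfolding inj_on_def by blast
    qed
    then have "{p. ?pull f p \<noteq> 0} = F" by auto
    moreover have "sum (?pull f) V = 1" using f'(3) inj by (simp add: sum.reindex o_def)
    ultimately show ?thesis using F(1) f'(1) in_realization_iff[OF V K, where f = "?pull f"] by simp
  qed
  have push: "?push g \<in> topspace (realization ?L)" if g: "g \<in> topspace (realization K)" for g
  proof -
    have g': "\<And>v. 0 \<le> g v" "{v. g v \<noteq> 0} \<in> K" "sum g V = 1"
      using g in_realization_iff[OF V K] by blast+
    have "{v. ?push g v \<noteq> 0} = e ` {p. g p \<noteq> 0}"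
    proof (intro equalityI subsetI)
      fix v assume "v \<in> e ` {p. g p \<noteq> 0}"
      then obtain p where "v = e p" "g p \<noteq> 0" "p \<in> V" using K[OF g'(2)] by blast
      then show "v \<in> {v. ?push g v \<noteq> 0}" using inv by simp
    qed (auto simp: inv split: if_splits)
    moreover have "sum (?push g) (e ` V) = 1" using g'(3) inj inv by (simp add: sum.reindex o_def)
    ultimately show ?thesis using g' in_realization_iff[OF fV L, where f = "?push g"] by simp
  qed
  have "homeomorphic_maps (realization ?L) (realization K) ?pull ?push"
    unfolding homeomorphic_maps_def
  proof (intro conjI ballI)
    show "continuous_map (realization ?L) (realization K) ?pull"
    proof (rule continuous_map_into_realization[OF _ pull])
      show "continuous_map (realization ?L) euclideanreal (\<lambda>f. ?pull f p)" for p
        by (cases "p \<in> V") (simp_all add: continuous_map_coordinate)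
    qed
    show "continuous_map (realization K) (realization ?L) ?push"
    proof (rule continuous_map_into_realization[OF _ push])
      show "continuous_map (realization K) euclideanreal (\<lambda>g. ?push g v)" for v
        by (cases "v \<in> e ` V") (simp_all add: continuous_map_coordinate)
    qed
  next
    fix f assume f: "f \<in> topspace (realization ?L)"
    then have "{v. f v \<noteq> 0} \<subseteq> e ` V" using L by (simp add: realization_def)
    then show "?push (?pull f) = f" using inv by (auto simp: fun_eq_iff)
  next
    fix g assume g: "g \<in> topspace (realization K)"
    then have "{v. g v \<noteq> 0} \<subseteq> V" using K by (simp add: realization_def)
    then show "?pull (?push g) = g" using inv by (auto simp: fun_eq_iff)
  qed
  then show ?thesis unfolding homeomorphic_space_def by blast
qed

text \<open>
  The induced subgraph on \<open>W\<close> is isomorphic to the model graph of \<open>k\<close> disjoint edges and a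
  complete graph on \<open>s + 1\<close> vertices.
\<close>

definition cross_shaped :: "'a set set \<Rightarrow> 'a set \<Rightarrow> nat \<Rightarrow> nat \<Rightarrow> bool" where
  "cross_shaped E W k s \<longleftrightarrow> (\<exists>e. inj_on e (cross_vertices k s) \<and> e ` cross_vertices k s = W \<and>
     (\<forall>p\<in>cross_vertices k s. \<forall>q\<in>cross_vertices k s. {e p, e q} \<in> E \<longleftrightarrow> {p, q} \<in> cross_edges))"

lemma simple_cross_edges: "simple_edges cross_edges"
  unfolding simple_edges_def cross_edges_def by blast

lemma cross_shaped_homotopy_equivalent:
  assumes E: "simple_edges E" and W: "cross_shaped E W k s" and s: "0 < s"
  shows "realization (indep_complex (W, E)) homotopy_equivalent_space wedge_of_spheres s k"
proof -
  let ?V = "cross_vertices k s"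
  obtain e where inj: "inj_on e ?V" and eW: "e ` ?V = W"
    and adj: "\<And>p q. p \<in> ?V \<Longrightarrow> q \<in> ?V \<Longrightarrow> {e p, e q} \<in> E \<longleftrightarrow> {p, q} \<in> cross_edges"
    using W unfolding cross_shaped_def by blast
  have face: "e ` F \<in> indep_complex (W, E) \<longleftrightarrow> F \<in> cross_complex k s" if F: "F \<subseteq> ?V" for F
  proof
    assume "e ` F \<in> indep_complex (W, E)"
    then have "{e p, e q} \<notin> E" if "p \<in> F" "q \<in> F" for p q
      using that by (auto simp: indep_complex_def)
    then show "F \<in> cross_complex k s"
      unfolding cross_complex_def using F adj by (intro indep_complexI simple_cross_edges) blast+
  next
    assume "F \<in> cross_complex k s"
    then have "{p, q} \<notin> cross_edges" if "p \<in> F" "q \<in> F" for p q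
      using that by (auto simp: cross_complex_def indep_complex_def)
    then show "e ` F \<in> indep_complex (W, E)"
      using F adj eW by (intro indep_complexI E) blast+
  qed
  have "indep_complex (W, E) = (`) e ` cross_complex k s"
  proof
    show "(`) e ` cross_complex k s \<subseteq> indep_complex (W, E)"
      using face cross_complex_subset by blast
    show "indep_complex (W, E) \<subseteq> (`) e ` cross_complex k s"
    proof
      fix G assume G: "G \<in> indep_complex (W, E)"
      then have "G \<subseteq> e ` ?V" using eW by (auto simp: indep_complex_def)
      then obtain F where "F \<subseteq> ?V" "G = e ` F" by (metis subset_imageE)
      then show "G \<in> (`) e ` cross_complex k s" using face G by blast
    qed
  qed
  then have "realization (indep_complex (W, E)) homeomorphic_space cross_space k s"
    using realization_image_homeomorphic[OF finite_cross_vertices inj cross_complex_subset] by simp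
  then show ?thesis
    using homeomorphic_imp_homotopy_equivalent_space homotopy_eqv_trans
      cross_space_homotopy_equivalent_wedge[OF s] by blast
qed

lemma clique_cross_shaped:
  assumes E: "simple_edges E" and W: "finite W" "card W = Suc s"
    and clique: "\<And>p q. p \<in> W \<Longrightarrow> q \<in> W \<Longrightarrow> p \<noteq> q \<Longrightarrow> {p, q} \<in> E"
  shows "cross_shaped E W 0 s"
proof -
  obtain h where h: "bij_betw h {..<Suc s} W"
    using ex_bij_betw_nat_finite[OF W(1)] W(2) by (auto simp: atLeast0LessThan)
  define e where "e = (\<lambda>v. case v of Apex i \<Rightarrow> h i | _ \<Rightarrow> undefined)"
  have V: "cross_vertices 0 s = Apex ` {..s}" by (auto simp: cross_vertices_def)
  have inj: "inj_on h {..s}" and img: "h ` {..s} = W"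
    using h by (auto simp: bij_betw_def lessThan_Suc_atMost)
  have eA: "e (Apex i) = h i" for i by (simp add: e_def)
  have "inj_on e (cross_vertices 0 s)"
    unfolding V using inj by (auto simp: inj_on_def eA)
  moreover have "e ` cross_vertices 0 s = W"
    unfolding V using img by (auto simp: image_image eA)
  moreover have "{e p, e q} \<in> E \<longleftrightarrow> {p, q} \<in> cross_edges" if "p \<in> cross_vertices 0 s" "q \<in> cross_vertices 0 s" for p q
  proof -
    obtain i j where ij: "p = Apex i" "q = Apex j" "i \<le> s" "j \<le> s" using \<open>p \<in> _\<close> \<open>q \<in> _\<close> unfolding V by blast
    have "{Apex i, Apex j} \<in> cross_edges \<longleftrightarrow> i \<noteq> j"
      by (auto simp: cross_edges_def doubleton_eq_iff)
    moreover have "{h i, h j} \<in> E \<longleftrightarrow> i \<noteq> j"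
    proof (cases "i = j")
      case True
      then show ?thesis using E unfolding simple_edges_def by (metis doubleton_eq_iff)
    next
      case False
      then have "h i \<noteq> h j" using inj ij by (auto simp: inj_on_def)
      then show ?thesis using False clique img ij by blast
    qed
    ultimately show ?thesis by (simp add: ij eA)
  qed
  ultimately show ?thesis unfolding cross_shaped_def by blast
qed

lemma cross_shaped_add_edge:
  assumes E: "simple_edges E" and W: "cross_shaped E W k s"
    and uw: "u \<notin> W" "w \<notin> W" "u \<noteq> w" "{u, w} \<in> E"
    and sep: "\<And>v. v \<in> W \<Longrightarrow> {u, v} \<notin> E" "\<And>v. v \<in> W \<Longrightarrow> {w, v} \<notin> E"
  shows "cross_shaped E (insert u (insert w W)) (Suc k) s"
proof -
  let ?V = "cross_vertices k s"
  let ?P = "Pos (Suc k)" and ?N = "Neg (Suc k)"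
  obtain e where inj: "inj_on e ?V" and eW: "e ` ?V = W"
    and adj: "\<And>p q. p \<in> ?V \<Longrightarrow> q \<in> ?V \<Longrightarrow> {e p, e q} \<in> E \<longleftrightarrow> {p, q} \<in> cross_edges"
    using W unfolding cross_shaped_def by blast
  define e' where "e' = e(?P := u, ?N := w)"
  have V': "cross_vertices (Suc k) s = insert ?P (insert ?N ?V)"
    by (auto simp: cross_vertices_def atLeastAtMostSuc_conv)
  have new: "?P \<notin> ?V" "?N \<notin> ?V" by (auto simp: cross_vertices_def)
  have e'V: "e' p = e p" if "p \<in> ?V" for p using that new by (auto simp: e'_def)
  have e'P: "e' ?P = u" and e'N: "e' ?N = w" by (simp_all add: e'_def)
  have "inj_on e' ?V" using inj by (simp add: inj_on_def e'V)
  moreover have img: "e' ` ?V = W" using eW by (simp add: e'V cong: image_cong)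
  ultimately have "inj_on e' (cross_vertices (Suc k) s)"
    unfolding V' using new uw by (simp add: e'P e'N)
  moreover have "e' ` cross_vertices (Suc k) s = insert u (insert w W)"
    unfolding V' by (simp add: e'P e'N img)
  moreover have "{e' p, e' q} \<in> E \<longleftrightarrow> {p, q} \<in> cross_edges"
    if p: "p \<in> cross_vertices (Suc k) s" and q: "q \<in> cross_vertices (Suc k) s" for p q
  proof -
    have nloop: "{v, v} \<notin> E" "{x, x} \<notin> cross_edges" for v x
      using E simple_cross_edges unfolding simple_edges_def by (metis doubleton_eq_iff)+
    have PN: "{?P, ?N} \<in> cross_edges" by (auto simp: cross_edges_def)
    have PV: "{?P, x} \<notin> cross_edges" "{?N, x} \<notin> cross_edges" if "x \<in> ?V" for x
      using that new by (auto simp: cross_edges_def doubleton_eq_iff)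
    have uV: "{u, e' x} \<notin> E" "{w, e' x} \<notin> E" if "x \<in> ?V" for x
      using that sep img by blast+
    consider "p = ?P" | "p = ?N" | "p \<in> ?V" using p unfolding V' by blast
    then show ?thesis
    proof cases
      case 1
      then show ?thesis using q nloop PN PV uV uw e'P e'N unfolding V' by auto
    next
      case 2
      then show ?thesis using q nloop PN PV uV uw e'P e'N unfolding V' by (auto simp: insert_commute)
    next
      case 3
      then show ?thesis using q PV uV e'P e'N adj e'V unfolding V' by (auto simp: insert_commute)
    qed
  qed
  ultimately show ?thesis unfolding cross_shaped_def by blast
qed

section \<open>Reduction by folds\<close>

definition folds_to_cross :: "'a set set \<Rightarrow> 'a set \<Rightarrow> nat \<Rightarrow> nat \<Rightarrow> bool" where
  "folds_to_cross E V k s \<longleftrightarrow> (\<exists>W. folds_to E V W \<and> cross_shaped E W k s)"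

definition folds_to_cone :: "'a set set \<Rightarrow> 'a set \<Rightarrow> bool" where
  "folds_to_cone E V \<longleftrightarrow> (\<exists>W. folds_to E V W \<and> (\<exists>u\<in>W. \<forall>w\<in>W. {u, w} \<notin> E))"

lemma folds_to_cross_realization:
  assumes "simple_edges E" "finite V" "folds_to_cross E V k s" "0 < s"
  shows "realization (indep_complex (V, E)) homotopy_equivalent_space wedge_of_spheres s k"
  using assms folds_to_homotopy_equivalent cross_shaped_homotopy_equivalent homotopy_eqv_trans
  unfolding folds_to_cross_def by metis

lemma folds_to_cone_realization:
  assumes "simple_edges E" "finite V" "folds_to_cone E V"
  shows "contractible_space (realization (indep_complex (V, E)))"
proof -
  obtain W u where "folds_to E V W" "u \<in> W" "\<And>w. w \<in> W \<Longrightarrow> {u, w} \<notin> E"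
    using assms(3) unfolding folds_to_cone_def by blast
  then show ?thesis
    using contractible_isolated_vertex[OF assms(1), of u W] folds_to_homotopy_equivalent[OF _ assms(1,2)]
      homotopy_equivalent_space_contractibility by blast
qed

text \<open>
  If \<open>A\<close> and \<open>B\<close> are completely joined, \<open>B\<close> contains all neighbors of \<open>u\<close> and \<open>A\<close> all those of \<open>w\<close>,
  then \<open>u\<close> dominates the rest of \<open>A\<close>. Once that is deleted, \<open>u\<close> is the only neighbor of \<open>w\<close>, which
  thus dominates the rest of \<open>B\<close>. What remains of \<open>A\<close> and \<open>B\<close> is an isolated edge.
\<close>

lemma full_block_folds:
  assumes V: "finite V" and A: "A \<subseteq> V" "u \<in> A" and B: "B \<subseteq> V" "w \<in> B" and disj: "A \<inter> B = {}"
    and full: "\<And>a b. a \<in> A \<Longrightarrow> b \<in> B \<Longrightarrow> {a, b} \<in> E"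
    and Nu: "\<And>v. v \<in> V \<Longrightarrow> {u, v} \<in> E \<Longrightarrow> v \<in> B"
    and Nw: "\<And>v. v \<in> V \<Longrightarrow> {w, v} \<in> E \<Longrightarrow> v \<in> A"
  shows "folds_to E V ({u, w} \<union> (V - A - B))"
proof -
  have "folds_to E V (V - (A - {u}))"
    by (rule folds_to_remove_dominated[of _ _ u]) (use V A Nu full in \<open>auto intro: finite_subset\<close>)
  moreover have "folds_to E (V - (A - {u})) (V - (A - {u}) - (B - {w}))"
  proof (rule folds_to_remove_dominated[of _ _ w])
    fix b v assume "b \<in> B - {w}" "v \<in> V - (A - {u})" "{w, v} \<in> E"
    then have "v = u" "b \<in> B" using Nw by blast+
    then show "{b, v} \<in> E" using full[OF A(2)] by (metis insert_commute)
  qed (use V A B disj in \<open>auto intro: finite_subset\<close>)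
  moreover have "V - (A - {u}) - (B - {w}) = {u, w} \<union> (V - A - B)" using A B disj by blast
  ultimately show ?thesis using folds_to_trans by metis
qed

text \<open>
  The isolated edge left by a full rectangle suspends the complex of the rest. If nothing is
  left besides, the edge serves as the complete graph of the model, which gives the \<open>0\<close>-sphere.
\<close>

lemma full_block_cross:
  assumes E: "simple_edges E" and V: "finite V" and A: "A \<subseteq> V" "u \<in> A" and B: "B \<subseteq> V" "w \<in> B" and disj: "A \<inter> B = {}"
    and full: "\<And>a b. a \<in> A \<Longrightarrow> b \<in> B \<Longrightarrow> {a, b} \<in> E"
    and Nu: "\<And>v. v \<in> V \<Longrightarrow> {u, v} \<in> E \<Longrightarrow> v \<in> B"
    and Nw: "\<And>v. v \<in> V \<Longrightarrow> {w, v} \<in> E \<Longrightarrow> v \<in> A"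
  shows "V - A - B = {} \<Longrightarrow> folds_to_cross E V 0 1"
    and "folds_to_cross E (V - A - B) k s \<Longrightarrow> folds_to_cross E V (Suc k) s"
    and "folds_to_cone E (V - A - B) \<Longrightarrow> folds_to_cone E V"
proof -
  note fold = full_block_folds[OF V A B disj full Nu Nw]
  have uw: "{u, w} \<in> E" "u \<noteq> w" using full A B disj by blast+
  have sep: "{u, v} \<notin> E" "{w, v} \<notin> E" if "v \<in> V - A - B" for v using that Nu Nw by blast+
  have lift: "folds_to E V ({u, w} \<union> W)" if "folds_to E (V - A - B) W" for W
  proof -
    have "folds_to E ({u, w} \<union> (V - A - B)) ({u, w} \<union> W)"
      using that sep A B by (intro folds_to_disjoint_union) (auto simp: insert_commute)
    then show ?thesis using fold folds_to_trans by blast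
  qed
  show "folds_to_cross E V 0 1" if "V - A - B = {}"
  proof -
    have "cross_shaped E {u, w} 0 1"
      using uw by (intro clique_cross_shaped[OF E]) (auto simp: insert_commute)
    then show ?thesis using fold that unfolding folds_to_cross_def by auto
  qed
  show "folds_to_cross E V (Suc k) s" if cross: "folds_to_cross E (V - A - B) k s"
  proof -
    obtain W where W: "folds_to E (V - A - B) W" "cross_shaped E W k s"
      using cross unfolding folds_to_cross_def by blast
    have WV: "W \<subseteq> V - A - B" by (rule folds_to_subset[OF W(1)])
    have "cross_shaped E (insert u (insert w W)) (Suc k) s"
      using WV A B uw sep by (intro cross_shaped_add_edge[OF E W(2)]) blast+
    then show ?thesis using lift[OF W(1)] unfolding folds_to_cross_def by auto
  qed
  show "folds_to_cone E V" if cone: "folds_to_cone E (V - A - B)"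
  proof -
    obtain W x where W: "folds_to E (V - A - B) W" "x \<in> W" "\<And>v. v \<in> W \<Longrightarrow> {x, v} \<notin> E"
      using cone unfolding folds_to_cone_def by blast
    have "x \<in> V - A - B" using folds_to_subset[OF W(1)] W(2) by blast
    then have "{x, v} \<notin> E" if "v \<in> {u, w} \<union> W" for v
      using that W(3)[of v] sep[of x] by (metis UnE insertE empty_iff insert_commute)
    then show ?thesis using lift[OF W(1)] W(2) unfolding folds_to_cone_def by blast
  qed
qed

section \<open>Convexity of shifted skew diagrams\<close>

text \<open>
  This captures the shape of \<open>D\<close> as far as folding is concerned: a cell in the north-west corner
  and a cell in the south-east corner of a rectangle force all positions of the rectangle above the diagonal to be
  cells. With degenerate rectangles this includes the convexity of rows and columns.
\<close>

definition shifted_convex :: "(nat \<times> nat) set \<Rightarrow> bool" where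
  "shifted_convex D \<longleftrightarrow> (\<forall>i j. (i, j) \<in> D \<longrightarrow> i < j) \<and>
     (\<forall>x c p d i j. (x, c) \<in> D \<longrightarrow> (p, d) \<in> D \<longrightarrow> x \<le> i \<longrightarrow> i \<le> p \<longrightarrow> c \<le> j \<longrightarrow> j \<le> d \<longrightarrow> i < j \<longrightarrow> (i, j) \<in> D)"

lemma shifted_convexD:
  assumes "shifted_convex D"
  shows "(i, j) \<in> D \<Longrightarrow> i < j"
    and "(x, c) \<in> D \<Longrightarrow> (p, d) \<in> D \<Longrightarrow> x \<le> i \<Longrightarrow> i \<le> p \<Longrightarrow> c \<le> j \<Longrightarrow> j \<le> d \<Longrightarrow> i < j \<Longrightarrow> (i, j) \<in> D"
  using assms unfolding shifted_convex_def by blast+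

text \<open>
  The ends \<open>i + \<lambda>\<^sub>i\<close> of the rows weakly decrease, and so do the numbers \<open>i + \<mu>\<^sub>i\<close> as long as
  \<open>\<mu>\<^sub>i > 0\<close>. Further down the rows start right at the diagonal.
\<close>

lemma shifted_skew_diagram_convex:
  assumes "shifted_skew_diagram D" shows "shifted_convex D"
proof -
  obtain l r lam mu where lam: "strict_antimono_on {1..l} lam" and mu: "strict_antimono_on {1..r} mu"
    and mu0: "\<And>i. i > r \<Longrightarrow> mu i = (0::nat)"
    and D: "D = {(i, j). 1 \<le> i \<and> i \<le> l \<and> i + mu i + 1 \<le> j \<and> j \<le> i + (lam i :: nat)}"
    using assms unfolding shifted_skew_diagram_def by blast
  have lam_mono: "k + lam k \<le> i + lam i" if "i \<le> k" "1 \<le> i" "k \<le> l" for i k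
    using that
  proof (induction k rule: dec_induct)
    case (step k)
    then have "lam (Suc k) < lam k" using lam by (auto simp: monotone_on_def)
    with step show ?case by auto
  qed auto
  have mu_mono: "k + mu k \<le> i + mu i" if "i \<le> k" "1 \<le> i" "k \<le> r" for i k
    using that
  proof (induction k rule: dec_induct)
    case (step k)
    then have "mu (Suc k) < mu k" using mu by (auto simp: monotone_on_def)
    with step show ?case by auto
  qed auto
  have "(i, j) \<in> D" if xc: "(x, c) \<in> D" and pd: "(p, d) \<in> D"
    and le: "x \<le> i" "i \<le> p" "c \<le> j" "j \<le> d" "i < j" for x c p d i j
  proof -
    have "d \<le> i + lam i" using lam_mono[of i p] xc pd le by (auto simp: D)
    moreover have "i + mu i + 1 \<le> j"
    proof (cases "i \<le> r")
      case True
      then show ?thesis using mu_mono[of x i] xc le by (auto simp: D)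
    next
      case False
      then show ?thesis using mu0[of i] le by simp
    qed
    ultimately show ?thesis using xc pd le by (auto simp: D)
  qed
  moreover have "i < j" if "(i, j) \<in> D" for i j using that by (auto simp: D)
  ultimately show ?thesis unfolding shifted_convex_def by blast
qed

section \<open>One step of the rectangular decomposition\<close>

lemma rect_decomp_no_top:
  assumes "finite X" "finite Y" "X \<noteq> {} \<or> Y \<noteq> {}" "\<not> top_cell D X Y"
    "empty_rows D X Y \<noteq> {} \<or> empty_cols D X Y \<noteq> {}"
  shows "rect_decomp D X Y = apfst ((#) (Empty_rect (empty_rows D X Y) (empty_cols D X Y)))
    (rect_decomp D (X - empty_rows D X Y) (Y - empty_cols D X Y))"
  using assms by (subst rect_decomp.simps) (auto simp add: Let_def)

lemma rect_decomp_full: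
  assumes "finite X" "finite Y" "top_cell D X Y"
    "(Max (top_rows D X Y), Min (top_cols D X Y)) \<in> bip_diagram D X Y"
  shows "rect_decomp D X Y = map_prod ((#) (Full_rect (top_rows D X Y) (top_cols D X Y)))
    ((\<union>) (new_excess D X Y (top_rows D X Y) (top_cols D X Y)))
    (rect_decomp D (X - top_rows D X Y) (Y - top_cols D X Y))"
  using assms by (subst rect_decomp.simps) (auto simp add: Let_def top_cell_def)

lemma rect_decomp_pedestal:
  assumes "finite X" "finite Y" "top_cell D X Y"
    "(Max (top_rows D X Y), Min (top_cols D X Y)) \<notin> bip_diagram D X Y"
  shows "rect_decomp D X Y = ([Pedestal (top_rows D X Y) (top_cols D X Y)],
    new_excess D X Y (top_rows D X Y) (top_cols D X Y))"
  using assms by (subst rect_decomp.simps) (auto simp add: Let_def top_cell_def)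

lemma rect_decomp_empty: "rect_decomp D {} {} = ([], {})"
  by (subst rect_decomp.simps) simp

text \<open>
  For folding, a full rectangle or pedestal is described by its bottom row \<open>m\<close> and its leftmost
  column \<open>n\<close>, where the cells of the last column and of the first row end.
\<close>

lemma top_cell_block:
  assumes fin: "finite X" "finite Y" and top: "top_cell D X Y"
  obtains m n where "m \<in> X" "n \<in> Y" "(m, Max Y) \<in> D" "(Min X, n) \<in> D"
    "Max (top_rows D X Y) = m" "Min (top_cols D X Y) = n"
    "top_rows D X Y = {x \<in> X. x \<le> m}" "top_cols D X Y = {y \<in> Y. n \<le> y}"
    "\<forall>x\<in>X. (x, Max Y) \<in> D \<longrightarrow> x \<le> m" "\<forall>y\<in>Y. (Min X, y) \<in> D \<longrightarrow> n \<le> y"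
proof -
  let ?A = "{u. (u, Max Y) \<in> bip_diagram D X Y}" and ?B = "{v. (Min X, v) \<in> bip_diagram D X Y}"
  have top': "Min X \<in> X" "Max Y \<in> Y" "(Min X, Max Y) \<in> D"
    using top fin by (auto simp: top_cell_def bip_diagram_def)
  have A: "finite ?A" "Min X \<in> ?A" and B: "finite ?B" "Max Y \<in> ?B"
    using top' by (auto simp: bip_diagram_def intro: finite_subset[OF _ fin(1)] finite_subset[OF _ fin(2)])
  have m: "Max ?A \<in> ?A" "\<And>u. u \<in> ?A \<Longrightarrow> u \<le> Max ?A" using A Max_in[of ?A] by auto
  have n: "Min ?B \<in> ?B" "\<And>u. u \<in> ?B \<Longrightarrow> Min ?B \<le> u" using B Min_in[of ?B] by auto
  have rows: "top_rows D X Y = {x \<in> X. x \<le> Max ?A}" and cols: "top_cols D X Y = {y \<in> Y. Min ?B \<le> y}"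
    by (auto simp: top_rows_def top_cols_def)
  show ?thesis
  proof (rule that[of "Max ?A" "Min ?B"])
    show "Max ?A \<in> X" "Min ?B \<in> Y" "(Max ?A, Max Y) \<in> D" "(Min X, Min ?B) \<in> D"
      using m(1) n(1) unfolding bip_diagram_def by blast+
    show "Max (top_rows D X Y) = Max ?A" unfolding rows
      using m(1) fin by (intro Max_eqI) (auto simp: bip_diagram_def)
    show "Min (top_cols D X Y) = Min ?B" unfolding cols
      using n(1) fin by (intro Min_eqI) (auto simp: bip_diagram_def)
    show "\<forall>x\<in>X. (x, Max Y) \<in> D \<longrightarrow> x \<le> Max ?A" "\<forall>y\<in>Y. (Min X, y) \<in> D \<longrightarrow> Min ?B \<le> y"
      using m(2) n(2) top' by (simp_all add: bip_diagram_def)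
  qed (fact rows cols)+
qed

lemma block_is_full:
  assumes D: "shifted_convex D" and "(Min X, n) \<in> D" "(m, Max Y) \<in> D" "finite X" "finite Y"
    and "x \<in> X" "y \<in> Y" "x \<le> m" "n \<le> y" "x < y"
  shows "(x, y) \<in> D"
  using shifted_convexD(2)[OF D assms(2,3), of x y] assms by simp

section \<open>The bipartite complexes\<close>

definition bip_edges :: "(nat \<times> nat) set \<Rightarrow> (nat + nat) set set" where
  "bip_edges D = {{Inl x, Inr y} | x y. (x, y) \<in> D}"

lemma simple_bip_edges: "simple_edges (bip_edges D)"
  unfolding simple_edges_def bip_edges_def by blast

lemma bip_edges_iff [simp]:
  "{Inl x, Inr y} \<in> bip_edges D \<longleftrightarrow> (x, y) \<in> D"
  "{Inr y, Inl x} \<in> bip_edges D \<longleftrightarrow> (x, y) \<in> D"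
  "{Inl x, Inl x'} \<notin> bip_edges D"
  "{Inr y, Inr y'} \<notin> bip_edges D"
  unfolding bip_edges_def by (auto simp: doubleton_eq_iff)

lemma indep_complex_bip_graph:
  "indep_complex (bip_graph D X Y) = indep_complex (X <+> Y, bip_edges D)"
proof -
  have sub: "{Inl x, Inr y} \<subseteq> X <+> Y \<longleftrightarrow> x \<in> X \<and> y \<in> Y" for x y by auto
  have "snd (bip_graph D X Y) = {e \<in> bip_edges D. e \<subseteq> X <+> Y}"
  proof (intro equalityI subsetI)
    fix e assume "e \<in> snd (bip_graph D X Y)"
    then obtain x y where "e = {Inl x, Inr y}" "(x, y) \<in> D" "x \<in> X" "y \<in> Y"
      unfolding bip_graph_def bip_diagram_def by auto
    then show "e \<in> {e \<in> bip_edges D. e \<subseteq> X <+> Y}" using sub by simp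
  next
    fix e assume e: "e \<in> {e \<in> bip_edges D. e \<subseteq> X <+> Y}"
    then obtain x y where xy: "e = {Inl x, Inr y}" "(x, y) \<in> D"
      unfolding bip_edges_def by blast
    then have "(x, y) \<in> bip_diagram D X Y" using e sub by (simp add: bip_diagram_def)
    then show "e \<in> snd (bip_graph D X Y)" using xy(1) unfolding bip_graph_def snd_conv by blast
  qed
  then have "bip_graph D X Y = (X <+> Y, {e \<in> bip_edges D. e \<subseteq> X <+> Y})"
    by (simp add: bip_graph_def)
  then show ?thesis by (simp only: indep_complex_induced)
qed

text \<open>
  A row or column without cells is an isolated vertex. A full rectangle splits off an edge. A
  pedestal has a bottom row \<open>m\<close> and a leftmost column \<open>n \<le> m\<close>: all cells of row \<open>m\<close> lie beyond
  column \<open>m\<close>, so row \<open>m\<close> dominates all rows above it, which are the only ones that meet column \<open>n\<close>.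
  Hence column \<open>n\<close> becomes an isolated vertex after folding.
\<close>

lemma bip_reduction:
  assumes "shifted_skew_diagram D" "finite X" "finite Y" "X \<noteq> {} \<or> Y \<noteq> {}"
  shows "(spherical D X Y \<longrightarrow> 1 \<le> bip_rect D X Y \<and> folds_to_cross (bip_edges D) (X <+> Y) (bip_rect D X Y - 1) 1) \<and>
    (\<not> spherical D X Y \<longrightarrow> folds_to_cone (bip_edges D) (X <+> Y))"
  using assms(2-4)
proof (induction "card X + card Y" arbitrary: X Y rule: less_induct)
  case less
  note fin = less.prems(1,2) and ne = less.prems(3)
  let ?E = "bip_edges D" and ?V = "X <+> Y"
  have D: "shifted_convex D" using assms(1) by (rule shifted_skew_diagram_convex)
  show ?case
  proof (cases "top_cell D X Y")
    case False
    have prog: "empty_rows D X Y \<noteq> {} \<or> empty_cols D X Y \<noteq> {}"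
      using no_top_cell_progress[OF assms(1) fin ne False] .
    then have "\<not> spherical D X Y"
      unfolding spherical_def rect_decomp_no_top[OF fin ne False prog] by simp
    moreover have "\<exists>u\<in>?V. \<forall>w\<in>?V. {u, w} \<notin> ?E"
      using prog
    proof
      assume "empty_rows D X Y \<noteq> {}"
      then obtain x where "x \<in> X" "\<And>y. y \<in> Y \<Longrightarrow> (x, y) \<notin> D"
        unfolding empty_rows_def bip_diagram_def by blast
      then show ?thesis by (intro bexI[of _ "Inl x"]) auto
    next
      assume "empty_cols D X Y \<noteq> {}"
      then obtain y where "y \<in> Y" "\<And>x. x \<in> X \<Longrightarrow> (x, y) \<notin> D"
        unfolding empty_cols_def bip_diagram_def by blast
      then show ?thesis by (intro bexI[of _ "Inr y"]) auto
    qed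
    ultimately show ?thesis unfolding folds_to_cone_def using folds_refl by blast
  next
    case top: True
    let ?R = "top_rows D X Y" and ?C = "top_cols D X Y"
    obtain m n where mn: "m \<in> X" "n \<in> Y" "(m, Max Y) \<in> D" "(Min X, n) \<in> D"
      and max: "Max ?R = m" "Min ?C = n"
      and R: "?R = {x \<in> X. x \<le> m}" and C: "?C = {y \<in> Y. n \<le> y}"
      and Rm: "\<forall>x\<in>X. (x, Max Y) \<in> D \<longrightarrow> x \<le> m"
      and Cn: "\<forall>y\<in>Y. (Min X, y) \<in> D \<longrightarrow> n \<le> y"
      by (rule top_cell_block[OF fin top])
    note cell = block_is_full[OF D mn(4,3) fin]
    have minmax: "Min X \<in> X" "Max Y \<in> Y" "\<And>x. x \<in> X \<Longrightarrow> Min X \<le> x" "\<And>y. y \<in> Y \<Longrightarrow> y \<le> Max Y"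
      using fin mn(1,2) by (auto intro!: Min_in Max_in)
    show ?thesis
    proof (cases "(m, n) \<in> D")
      case True
      then have mn_cell: "(Max ?R, Min ?C) \<in> bip_diagram D X Y" using mn max by (simp add: bip_diagram_def)
      have lt: "m < n" by (rule shifted_convexD(1)[OF D True])
      let ?X = "X - ?R" and ?Y = "Y - ?C"
      have full: "(x, y) \<in> D" if "x \<in> ?R" "y \<in> ?C" for x y
        using that lt unfolding R C by (intro cell) auto
      note step = rect_decomp_full[OF fin top mn_cell]
      have sph: "spherical D X Y \<longleftrightarrow> spherical D ?X ?Y"
        unfolding spherical_def step by simp
      have rect: "bip_rect D X Y = Suc (bip_rect D ?X ?Y)"
        unfolding bip_rect_def count_rect_def step by simp
      let ?A = "Inl ` ?R :: (nat + nat) set" and ?B = "Inr ` ?C :: (nat + nat) set"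
      have rest: "?V - ?A - ?B = ?X <+> ?Y" by auto
      have V: "finite ?V" using fin by simp
      have A: "?A \<subseteq> ?V" "Inl (Min X) \<in> ?A" using minmax mn(1) unfolding R by auto
      have B: "?B \<subseteq> ?V" "Inr (Max Y) \<in> ?B" using minmax mn(2) unfolding C by auto
      have 1: "?A \<inter> ?B = {}" by blast
      have 2: "{a, b} \<in> ?E" if "a \<in> ?A" "b \<in> ?B" for a b
        using that full by auto
      have 3: "v \<in> ?B" if "v \<in> ?V" "{Inl (Min X), v} \<in> ?E" for v
        using that Cn unfolding C by auto
      have 4: "v \<in> ?A" if "v \<in> ?V" "{Inr (Max Y), v} \<in> ?E" for v
        using that Rm unfolding R by auto
      note block = full_block_cross[OF simple_bip_edges V A B 1 2 3 4, unfolded rest]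
      show ?thesis
      proof (cases "?X = {} \<and> ?Y = {}")
        case True
        then have e: "?X = {}" "?Y = {}" by blast+
        have rd: "rect_decomp D ?X ?Y = ([], {})" unfolding e by (rule rect_decomp_empty)
        have "bip_rect D ?X ?Y = 0" "spherical D ?X ?Y"
          by (simp_all add: bip_rect_def spherical_def rd count_rect_def)
        moreover have "?X <+> ?Y = {}" unfolding e by simp
        ultimately show ?thesis using block(1) sph rect by simp
      next
        case False
        have "card ?X + card ?Y < card X + card Y"
          using fin mn(1) by (intro card_Diff_less) (auto simp: R C)
        then have IH: "(spherical D ?X ?Y \<longrightarrow> 1 \<le> bip_rect D ?X ?Y \<and> folds_to_cross ?E (?X <+> ?Y) (bip_rect D ?X ?Y - 1) 1) \<and>
          (\<not> spherical D ?X ?Y \<longrightarrow> folds_to_cone ?E (?X <+> ?Y))"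
          using less.hyps[of ?X ?Y] fin False by blast
        show ?thesis
        proof (cases "spherical D ?X ?Y")
          case True
          then show ?thesis using IH block(2)[of "bip_rect D ?X ?Y - 1" 1] sph rect by simp
        next
          case False
          then show ?thesis using IH block(3) sph by simp
        qed
      qed
    next
      case False
      then have mn_cell: "(Max ?R, Min ?C) \<notin> bip_diagram D X Y" using max by (simp add: bip_diagram_def)
      \<comment> \<open>Otherwise the position \<open>(m, n)\<close> would be above the diagonal, hence a cell.\<close>
      have "n \<le> m" using False cell[of m n] mn(1,2) by force
      have "\<not> spherical D X Y"
        unfolding spherical_def rect_decomp_pedestal[OF fin top mn_cell] by simp
      moreover have "folds_to ?E ?V (?V - Inl ` {x \<in> X. x < m})"
      proof (rule folds_to_remove_dominated[of _ _ "Inl m"])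
        fix v w :: "nat + nat" assume v: "v \<in> Inl ` {x \<in> X. x < m}" and w: "w \<in> ?V" "{Inl m, w} \<in> ?E"
        obtain x where x: "v = Inl x" "x \<in> X" "x < m" using v by blast
        obtain y where y: "w = Inr y" "y \<in> Y" "(m, y) \<in> D" using w by auto
        have "m < y" by (rule shifted_convexD(1)[OF D y(3)])
        then have "(x, y) \<in> D" using x y \<open>n \<le> m\<close> by (intro cell) auto
        then show "{v, w} \<in> ?E" using x y by simp
      qed (use fin mn(1) in auto)
      moreover have "{Inr n, w} \<notin> ?E" if "w \<in> ?V - Inl ` {x \<in> X. x < m}" for w
      proof
        assume "{Inr n, w} \<in> ?E"
        with that obtain x where "w = Inl x" "x \<in> X" "(x, n) \<in> D" by auto
        moreover from this have "x < n" using shifted_convexD(1)[OF D] by blast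
        ultimately show False using that \<open>n \<le> m\<close> by auto
      qed
      moreover have "Inr n \<in> ?V - Inl ` {x \<in> X. x < m}" using mn(2) by auto
      ultimately show ?thesis unfolding folds_to_cone_def by blast
    qed
  qed
qed

lemma bip_homotopy_type:
  assumes D: "shifted_skew_diagram D" and fin: "finite X" "finite Y" and ne: "X \<noteq> {} \<or> Y \<noteq> {}"
  shows "spherical D X Y \<Longrightarrow> 1 \<le> bip_rect D X Y \<and>
      realization (indep_complex (bip_graph D X Y)) homotopy_equivalent_space nsphere (bip_rect D X Y - 1)"
    and "\<not> spherical D X Y \<Longrightarrow> contractible_space (realization (indep_complex (bip_graph D X Y)))"
proof -
  note red = bip_reduction[OF D fin ne]
  have V: "finite (X <+> Y)" using fin by simp
  show "1 \<le> bip_rect D X Y \<and>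
      realization (indep_complex (bip_graph D X Y)) homotopy_equivalent_space nsphere (bip_rect D X Y - 1)"
    if "spherical D X Y"
  proof -
    have "realization (indep_complex (bip_graph D X Y)) homotopy_equivalent_space wedge_of_spheres 1 (bip_rect D X Y - 1)"
      unfolding indep_complex_bip_graph using red that
      by (intro folds_to_cross_realization[OF simple_bip_edges V]) auto
    moreover have "wedge_of_spheres 1 (bip_rect D X Y - 1) homotopy_equivalent_space nsphere (bip_rect D X Y - 1)"
      using nsphere_homeomorphic_wedge homeomorphic_imp_homotopy_equivalent_space homotopy_equivalent_space_sym by blast
    ultimately show ?thesis using red that homotopy_eqv_trans by blast
  qed
  show "contractible_space (realization (indep_complex (bip_graph D X Y)))" if "\<not> spherical D X Y"
    unfolding indep_complex_bip_graph using red that by (intro folds_to_cone_realization[OF simple_bip_edges V]) auto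
qed

section \<open>The nonbipartite complexes\<close>

definition nonbip_edges :: "(nat \<times> nat) set \<Rightarrow> nat set set" where
  "nonbip_edges D = {{x, x'} | x x'. (x, x') \<in> D}"

lemma nonbip_edges_iff: "{x, y} \<in> nonbip_edges D \<longleftrightarrow> (x, y) \<in> D \<or> (y, x) \<in> D"
  unfolding nonbip_edges_def by (auto simp: doubleton_eq_iff)

lemma simple_nonbip_edges:
  assumes "shifted_convex D" shows "simple_edges (nonbip_edges D)"
  unfolding simple_edges_def
proof
  fix e assume "e \<in> nonbip_edges D"
  then obtain x y where xy: "e = {x, y}" "(x, y) \<in> D" unfolding nonbip_edges_def by blast
  then have "x \<noteq> y" using shifted_convexD(1)[OF assms xy(2)] by simp
  then show "\<exists>p q. p \<noteq> q \<and> e = {p, q}" using xy(1) by blast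
qed

lemma indep_complex_nonbip_graph:
  "indep_complex (nonbip_graph D X) = indep_complex (X, nonbip_edges D)"
proof -
  have "snd (nonbip_graph D X) = {e \<in> nonbip_edges D. e \<subseteq> X}"
    unfolding nonbip_graph_def nonbip_edges_def bip_diagram_def by auto
  then have "nonbip_graph D X = (X, {e \<in> nonbip_edges D. e \<subseteq> X})"
    by (simp add: nonbip_graph_def)
  then show ?thesis by (simp only: indep_complex_induced)
qed

text \<open>
  The invariant of the decomposition that starts from \<open>Y = X\<close>: a column whose vertex is no longer a
  row meets the remaining rows below the diagonal only, and likewise with rows and columns
  interchanged. The graph that remains to be studied therefore has the vertex set \<open>X \<inter> Y\<close>.
\<close>

definition diagonal_pair :: "nat set \<Rightarrow> nat set \<Rightarrow> bool" where
  "diagonal_pair X Y \<longleftrightarrow> (\<forall>y\<in>Y - X. \<forall>x\<in>X. y < x) \<and> (\<forall>x\<in>X - Y. \<forall>y\<in>Y. y < x)"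

text \<open>
  The set \<open>Z\<close>, in which the two indices of a staircase cell have to be neighbors, stays the original
  vertex set while \<open>X\<close> and \<open>Y\<close> shrink.
\<close>

definition stairs :: "(nat \<times> nat) set \<Rightarrow> nat set \<Rightarrow> nat set \<Rightarrow> nat set \<Rightarrow> (nat \<times> nat) set" where
  "stairs D Z X Y = {(x, y) \<in> bip_diagram D X Y. x < y \<and> {x<..<y} \<inter> Z = {}}"

definition upper_blocks :: "(nat \<times> nat) set \<Rightarrow> nat set \<Rightarrow> nat set \<Rightarrow> block list" where
  "upper_blocks D X Y = filter (\<lambda>b. \<not> below_diagonal b) (fst (rect_decomp D X Y))"

text \<open>
  Once all vertices have been used up, the remaining positions are below the diagonal and form a
  single empty rectangle, which is not counted.
\<close>

lemma rect_decomp_exhausted: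
  assumes D: "shifted_convex D" and fin: "finite X" "finite Y" and ne: "X \<noteq> {}" "Y \<noteq> {}"
    and diag: "diagonal_pair X Y" and disj: "X \<inter> Y = {}"
  shows "rect_decomp D X Y = ([Empty_rect X Y], {})" "upper_blocks D X Y = []"
proof -
  have lt: "y < x" if "x \<in> X" "y \<in> Y" for x y
    using that diag disj unfolding diagonal_pair_def by blast
  have no: "(x, y) \<notin> D" if "x \<in> X" "y \<in> Y" for x y
    using shifted_convexD(1)[OF D, of x y] lt[OF that] by auto
  then have bip: "bip_diagram D X Y = {}" by (auto simp: bip_diagram_def)
  then have rows: "empty_rows D X Y = X" "empty_cols D X Y = Y" and top: "\<not> top_cell D X Y"
    by (auto simp: empty_rows_def empty_cols_def top_cell_def)
  have "rect_decomp D X Y = apfst ((#) (Empty_rect X Y)) (rect_decomp D (X - X) (Y - Y))"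
    using rect_decomp_no_top[OF fin _ top] ne unfolding rows by blast
  then show rd: "rect_decomp D X Y = ([Empty_rect X Y], {})" by (simp add: rect_decomp_empty)
  have "below_diagonal (Empty_rect X Y)" using ne lt by (simp add: below_diagonal_def)
  then show "upper_blocks D X Y = []" by (simp add: upper_blocks_def rd)
qed

text \<open>
  A staircase cell of the pedestal is determined by its row. Its row is one of the elements
  between \<open>n\<close> and \<open>m\<close>, or else the last element \<open>r\<close> before \<open>n\<close>, whose successor is \<open>n\<close>.
\<close>

lemma pedestal_staircase_card:
  fixes V :: "nat set" and m n p q :: nat
  assumes V: "finite V" and p: "p \<in> V" "p < n" "n \<in> V" "n \<le> m" and q: "q \<in> V" "m < q"
    and range: "\<And>z. z \<in> Z \<Longrightarrow> p \<le> z \<Longrightarrow> z \<le> q \<Longrightarrow> z \<in> V" and VZ: "V \<subseteq> Z"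
    and T: "T = {(x, y). x \<in> V \<and> y \<in> V \<and> x \<le> m \<and> n \<le> y \<and> x < y \<and> {x<..<y} \<inter> Z = {}}"
    and pV: "\<And>z. z \<in> V \<Longrightarrow> p \<le> z \<and> z \<le> q"
  shows "card T = Suc (card {z \<in> V. n \<le> z \<and> z \<le> m})"
proof -
  let ?I = "{z \<in> V. n \<le> z \<and> z \<le> m}"
  define r where "r = Max {z \<in> V. z < n}"
  have r_in: "r \<in> {z \<in> V. z < n}"
    unfolding r_def using V p by (intro Max_in) auto
  have r_max: "z \<le> r" if "z \<in> V" "z < n" for z
    unfolding r_def using V that by (intro Max_ge) auto
  have "inj_on fst T"
  proof (rule inj_onI)
    fix a b assume a: "a \<in> T" and b: "b \<in> T" and eq: "fst a = fst b"
    obtain x y y' where ab: "a = (x, y)" "b = (x, y')" using eq by (metis prod.collapse)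
    have "\<not> y < y'" "\<not> y' < y" using a b VZ unfolding ab T by auto
    then show "a = b" using ab by simp
  qed
  moreover have "fst ` T = insert r ?I"
  proof (intro equalityI subsetI)
    fix x assume "x \<in> fst ` T"
    then obtain y where xy: "x \<in> V" "y \<in> V" "x \<le> m" "n \<le> y" "x < y" "{x<..<y} \<inter> Z = {}"
      unfolding T by auto
    show "x \<in> insert r ?I"
    proof (cases "n \<le> x")
      case False
      then have "x \<le> r" using r_max xy(1) by simp
      moreover have "\<not> x < r"
      proof
        assume "x < r"
        then have "r \<in> {x<..<y} \<inter> Z" using r_in xy(4) VZ by auto
        then show False using xy(6) by blast
      qed
      ultimately show ?thesis by simp
    qed (use xy in simp)
  next
    fix x assume x: "x \<in> insert r ?I"
    then have xV: "x \<in> V" "x \<le> m" using r_in p(4) by auto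
    define y where "y = Min {z \<in> V. x < z}"
    have y_in: "y \<in> {z \<in> V. x < z}"
      unfolding y_def using V q xV by (intro Min_in) auto
    have y_min: "y \<le> z" if "z \<in> V" "x < z" for z
      unfolding y_def using V that by (intro Min_le) auto
    have "n \<le> y"
    proof (rule ccontr)
      assume "\<not> n \<le> y"
      then have "y \<le> r" using r_max y_in by simp
      then show False using x y_in \<open>\<not> n \<le> y\<close> by auto
    qed
    moreover have "{x<..<y} \<inter> Z = {}"
    proof (rule ccontr)
      assume "{x<..<y} \<inter> Z \<noteq> {}"
      then obtain z where z: "z \<in> Z" "x < z" "z < y" by auto
      then have "z \<in> V" using pV[OF xV(1)] pV[of y] y_in by (intro range) auto
      then show False using y_min z by fastforce
    qed
    ultimately have "(x, y) \<in> T" using xV y_in unfolding T by simp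
    then show "x \<in> fst ` T" by force
  qed
  ultimately have "card T = card (insert r ?I)" by (metis card_image)
  also have "\<dots> = Suc (card ?I)" using V r_in by simp
  finally show ?thesis .
qed

lemma empty_rows_Min:
  assumes "finite X" "empty_rows D X Y \<noteq> {}"
  shows "Min X \<in> empty_rows D X Y" "w \<in> Y \<Longrightarrow> (Min X, w) \<notin> D"
proof -
  obtain x where x: "x \<in> empty_rows D X Y" using assms(2) by blast
  then have no: "(u, y) \<notin> D" if "u \<in> X" "u \<le> x" "y \<in> Y" for u y
    using that unfolding empty_rows_def bip_diagram_def by blast
  have min: "Min X \<in> X" "Min X \<le> x"
    using x assms(1) by (auto simp: empty_rows_def intro!: Min_in)
  show "(Min X, w) \<notin> D" if "w \<in> Y" by (rule no[OF min that])
  have "(u, y) \<notin> D" if "u \<in> X" "u \<le> Min X" "y \<in> Y" for u y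
    using that min by (intro no) auto
  then show "Min X \<in> empty_rows D X Y"
    using min(1) by (simp add: empty_rows_def bip_diagram_def)
qed

lemma empty_cols_Max:
  assumes "finite Y" "empty_cols D X Y \<noteq> {}"
  shows "Max Y \<in> empty_cols D X Y" "w \<in> X \<Longrightarrow> (w, Max Y) \<notin> D"
proof -
  obtain y where y: "y \<in> empty_cols D X Y" using assms(2) by blast
  then have no: "(x, v) \<notin> D" if "v \<in> Y" "y \<le> v" "x \<in> X" for x v
    using that unfolding empty_cols_def bip_diagram_def by blast
  have max: "Max Y \<in> Y" "y \<le> Max Y"
    using y assms(1) by (auto simp: empty_cols_def intro!: Max_in)
  show "(w, Max Y) \<notin> D" if "w \<in> X" by (rule no[OF max that])
  have "(x, v) \<notin> D" if "v \<in> Y" "Max Y \<le> v" "x \<in> X" for x v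
    using that max by (intro no) auto
  then show "Max Y \<in> empty_cols D X Y"
    using max(1) by (simp add: empty_cols_def bip_diagram_def)
qed

text \<open>
  The first vertex has neighbors only to its right, and the last one only to its left. If there
  is no top cell, one of these two is isolated. A full rectangle splits off an edge; it contains
  a non-excess staircase cell exactly when it uses up the last vertices, and this is then the
  only one. In a pedestal with bottom row \<open>m\<close> and leftmost column \<open>n \<le> m\<close>, the first vertex
  dominates the other vertices before \<open>n\<close>, and the last vertex those after \<open>m\<close>. The first and the
  last vertex and those between \<open>n\<close> and \<open>m\<close> are left. They are pairwise adjacent, and there is one
  more of them than there are staircase cells in the pedestal.
\<close>

lemma nonbip_reduction:
  assumes SD: "shifted_skew_diagram D" and "finite X" "finite Y" "diagonal_pair X Y" "X \<inter> Y \<noteq> {}"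
  shows "if \<exists>b\<in>set (upper_blocks D X Y). is_empty_rect b then folds_to_cone (nonbip_edges D) (X \<inter> Y)
    else 1 \<le> count_rect (upper_blocks D X Y) \<and>
      0 < card (stairs D (X \<union> Y) X Y - snd (rect_decomp D X Y)) \<and>
      folds_to_cross (nonbip_edges D) (X \<inter> Y) (count_rect (upper_blocks D X Y) - 1)
        (card (stairs D (X \<union> Y) X Y - snd (rect_decomp D X Y)))"
  using assms(2-5)
proof (induction "card X + card Y" arbitrary: X Y rule: less_induct)
  case less
  note fin = less.prems(1,2) and diag = less.prems(3)
  let ?E = "nonbip_edges D" and ?V = "X \<inter> Y" and ?Z = "X \<union> Y"
  have D: "shifted_convex D" using SD by (rule shifted_skew_diagram_convex)
  note E = simple_nonbip_edges[OF D]
  obtain v where v: "v \<in> X" "v \<in> Y" using less.prems(4) by blast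
  have ne: "X \<noteq> {}" "Y \<noteq> {}" using v by blast+
  have min: "Min X \<in> X" "\<And>x. x \<in> X \<Longrightarrow> Min X \<le> x" and max: "Max Y \<in> Y" "\<And>y. y \<in> Y \<Longrightarrow> y \<le> Max Y"
    using fin ne by auto
  \<comment> \<open>Up to the last column every row is a vertex that is still in use, and so is every column from the first row on.\<close>
  have XY: "x \<in> Y" if "x \<in> X" "x \<le> Max Y" for x
    using that diag max(1) unfolding diagonal_pair_def by (metis Diff_iff not_le)
  have YX: "y \<in> X" if "y \<in> Y" "Min X \<le> y" for y
    using that diag min(1) unfolding diagonal_pair_def by (metis Diff_iff not_le)
  have le: "Min X \<le> Max Y" using min(2)[OF v(1)] max(2)[OF v(2)] by simp
  have minV: "Min X \<in> ?V" and maxV: "Max Y \<in> ?V" using XY[OF min(1) le] YX[OF max(1) le] min(1) max(1) by blast+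
  have noup: "(w, Min X) \<notin> D" if "w \<in> X" for w
    using shifted_convexD(1)[OF D, of w "Min X"] min(2)[OF that] by linarith
  have nodown: "(Max Y, w) \<notin> D" if "w \<in> Y" for w
    using shifted_convexD(1)[OF D, of "Max Y" w] max(2)[OF that] by linarith
  show ?case
  proof (cases "top_cell D X Y")
    case False
    let ?er = "empty_rows D X Y" and ?ec = "empty_cols D X Y"
    have prog: "?er \<noteq> {} \<or> ?ec \<noteq> {}"
      using no_top_cell_progress[OF SD fin _ False] ne by blast
    note er = empty_rows_Min[OF fin(1)] and ec = empty_cols_Max[OF fin(2)]
    have "\<not> below_diagonal (Empty_rect ?er ?ec)"
    proof
      assume "below_diagonal (Empty_rect ?er ?ec)"
      then have "?er \<noteq> {}" "?ec \<noteq> {}" "\<forall>x\<in>?er. \<forall>y\<in>?ec. y < x"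
        by (simp_all add: below_diagonal_def)
      then have "Max Y < Min X" using er(1) ec(1) by blast
      then show False using le by simp
    qed
    then have "\<exists>b\<in>set (upper_blocks D X Y). is_empty_rect b"
      unfolding upper_blocks_def using rect_decomp_no_top[OF fin _ False prog] ne by simp
    moreover have "\<exists>u\<in>?V. \<forall>w\<in>?V. {u, w} \<notin> ?E"
      using prog
    proof
      assume "?er \<noteq> {}"
      then show ?thesis using er(2) noup minV by (intro bexI[of _ "Min X"]) (auto simp: nonbip_edges_iff)
    next
      assume "?ec \<noteq> {}"
      then show ?thesis using ec(2) nodown maxV by (intro bexI[of _ "Max Y"]) (auto simp: nonbip_edges_iff)
    qed
    ultimately show ?thesis unfolding folds_to_cone_def using folds_refl by fastforce
  next
    case top: True
    let ?R = "top_rows D X Y" and ?C = "top_cols D X Y"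
    obtain m n where mn: "m \<in> X" "n \<in> Y" "(m, Max Y) \<in> D" "(Min X, n) \<in> D"
      and mnR: "Max ?R = m" "Min ?C = n"
      and R: "?R = {x \<in> X. x \<le> m}" and C: "?C = {y \<in> Y. n \<le> y}"
      and Rm: "\<forall>x\<in>X. (x, Max Y) \<in> D \<longrightarrow> x \<le> m"
      and Cn: "\<forall>y\<in>Y. (Min X, y) \<in> D \<longrightarrow> n \<le> y"
      by (rule top_cell_block[OF fin top])
    note cell = block_is_full[OF D mn(4,3) fin]
    have lt: "Min X < n" "m < Max Y" using shifted_convexD(1)[OF D] mn by blast+
    have RV: "?R \<subseteq> ?V" and CV: "?C \<subseteq> ?V" using XY YX lt unfolding R C by fastforce+
    have mV: "m \<in> ?V" and nV: "n \<in> ?V" using RV CV mn unfolding R C by auto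
    have block_mem: "Min X \<in> ?R" "Max Y \<in> ?C" using min max mn unfolding R C by auto
    have range: "z \<in> ?V" if "z \<in> ?Z" "Min X \<le> z" "z \<le> Max Y" for z using that XY YX by blast
    have Nmin: "(Min X, w) \<in> D \<and> n \<le> w" if "w \<in> ?V" "{Min X, w} \<in> ?E" for w
      using that noup Cn by (auto simp: nonbip_edges_iff)
    have Nmax: "(w, Max Y) \<in> D \<and> w \<le> m" if "w \<in> ?V" "{Max Y, w} \<in> ?E" for w
      using that nodown Rm by (auto simp: nonbip_edges_iff)
    let ?new = "new_excess D X Y ?R ?C"
    show ?thesis
    proof (cases "(m, n) \<in> D")
      case True
      then have mn_cell: "(Max ?R, Min ?C) \<in> bip_diagram D X Y" using mn mnR by (simp add: bip_diagram_def)
      have mn_lt: "m < n" by (rule shifted_convexD(1)[OF D True])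
      let ?X = "X - ?R" and ?Y = "Y - ?C"
      note step = rect_decomp_full[OF fin top mn_cell]
      have disj: "?R \<inter> ?C = {}" using mn_lt unfolding R C by auto
      have full: "{a, b} \<in> ?E" if "a \<in> ?R" "b \<in> ?C" for a b
        using that mn_lt cell[of a b] unfolding R C by (auto simp: nonbip_edges_iff)
      have Nu: "w \<in> ?C" if "w \<in> ?V" "{Min X, w} \<in> ?E" for w
        using that Nmin unfolding C by auto
      have Nw: "w \<in> ?R" if "w \<in> ?V" "{Max Y, w} \<in> ?E" for w
        using that Nmax unfolding R by auto
      have rest: "?V - ?R - ?C = ?X \<inter> ?Y" by blast
      have Vfin: "finite ?V" using fin by simp
      note block = full_block_cross[OF E Vfin RV block_mem(1) CV block_mem(2) disj full Nu Nw, unfolded rest]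
      \<comment> \<open>Used rows stay behind as columns, and used columns as rows, so the original vertex set is still the union.\<close>
      have Z: "?X \<union> ?Y = ?Z" using RV CV disj by blast
      have fin': "finite ?X" "finite ?Y" using fin by auto
      have ne': "?X \<noteq> {}" "?Y \<noteq> {}" using block_mem RV CV disj by blast+
      have diag': "diagonal_pair ?X ?Y"
        unfolding diagonal_pair_def
      proof (intro conjI ballI)
        fix y x assume y: "y \<in> ?Y - ?X" and x: "x \<in> ?X"
        show "y < x"
        proof (cases "y \<in> X")
          case True
          then show ?thesis using x y unfolding R by auto
        next
          case False
          then show ?thesis using x y diag unfolding diagonal_pair_def by blast
        qed
      next
        fix x y assume x: "x \<in> ?X - ?Y" and y: "y \<in> ?Y"
        show "y < x"
        proof (cases "x \<in> Y")
          case True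
          then show ?thesis using x y unfolding C by auto
        next
          case False
          then show ?thesis using x y diag unfolding diagonal_pair_def by blast
        qed
      qed
      have "\<not> below_diagonal (Full_rect ?R ?C)"
        unfolding below_diagonal_def using block_mem le by (auto simp: not_less)
      then have blocks: "upper_blocks D X Y = Full_rect ?R ?C # upper_blocks D ?X ?Y"
        unfolding upper_blocks_def step by simp
      have excess: "snd (rect_decomp D X Y) = ?new \<union> snd (rect_decomp D ?X ?Y)"
        unfolding step by simp
      have new_iff: "(x, y) \<in> ?new \<longleftrightarrow> (x, y) \<in> D \<and> (x \<in> ?X \<and> y \<in> ?C \<or> x \<in> ?R \<and> y \<in> ?Y)" for x y
        by (auto simp: new_excess_def bip_diagram_def)
      show ?thesis
      proof (cases "?X \<inter> ?Y = {}")
        case V2: True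
        note exh = rect_decomp_exhausted[OF D fin' ne' diag' V2]
        \<comment> \<open>No vertex is left between \<open>m\<close> and \<open>n\<close>.\<close>
        have "stairs D ?Z X Y - ?new = {(m, n)}"
        proof (intro equalityI subsetI)
          fix c assume c: "c \<in> stairs D ?Z X Y - ?new"
          obtain x y where xy: "c = (x, y)" by fastforce
          then have st: "(x, y) \<in> D" "x \<in> X" "y \<in> Y" "x < y" "{x<..<y} \<inter> ?Z = {}" "(x, y) \<notin> ?new"
            using c by (auto simp: stairs_def bip_diagram_def)
          have "\<not> (x \<in> ?X \<and> y \<in> ?Y)"
            using diag' V2 st(4) unfolding diagonal_pair_def by (meson Diff_iff disjoint_iff not_less_iff_gr_or_eq)
          then have "x \<in> ?R" "y \<in> ?C" using st unfolding new_iff by blast+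
          then have "x \<le> m" "n \<le> y" unfolding R C by auto
          moreover have "m \<notin> {x<..<y}" "n \<notin> {x<..<y}" using st(5) mn by blast+
          ultimately have "x = m" "y = n" using mn_lt by auto
          then show "c \<in> {(m, n)}" using xy by simp
        next
          fix c assume "c \<in> {(m, n)}"
          then have c: "c = (m, n)" by simp
          have "z \<notin> ?Z" if "m < z" "z < n" for z
          proof
            assume "z \<in> ?Z"
            then have "z \<in> ?V" using that min(2)[OF mn(1)] max(2)[OF mn(2)] by (intro range) auto
            then have "z \<in> ?X \<inter> ?Y" using that unfolding R C by auto
            then show False using V2 by blast
          qed
          then have "{m<..<n} \<inter> ?Z = {}" by auto
          moreover have "m \<in> ?R" "n \<in> ?C" using mn(1,2) by (simp_all add: R C)
          then have "(m, n) \<notin> ?new" unfolding new_iff by blast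
          ultimately show "c \<in> stairs D ?Z X Y - ?new"
            unfolding c using True mn mn_lt by (simp add: stairs_def bip_diagram_def)
        qed
        then have "card (stairs D ?Z X Y - snd (rect_decomp D X Y)) = 1"
          unfolding excess exh by simp
        moreover have "count_rect (upper_blocks D X Y) = 1" "\<not> (\<exists>b\<in>set (upper_blocks D X Y). is_empty_rect b)"
          unfolding blocks exh by (simp_all add: count_rect_def)
        ultimately show ?thesis using block(1) V2 by simp
      next
        case V2: False
        then obtain z where z: "z \<in> ?X" "z \<in> ?Y" by blast
        \<comment> \<open>The vertex \<open>z\<close> separates the rows from the columns of the rectangle, so that it has no staircase cells.\<close>
        have z': "m < z" "z < n" using z unfolding R C by auto
        have "stairs D ?Z X Y - ?new \<subseteq> stairs D ?Z ?X ?Y"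
        proof
          fix c assume c: "c \<in> stairs D ?Z X Y - ?new"
          obtain x y where xy: "c = (x, y)" by fastforce
          then have st: "(x, y) \<in> D" "x \<in> X" "y \<in> Y" "x < y" "{x<..<y} \<inter> ?Z = {}" "(x, y) \<notin> ?new"
            using c by (auto simp: stairs_def bip_diagram_def)
          have "z \<notin> {x<..<y}" using st(5) z by blast
          then have "\<not> (x \<in> ?R \<and> y \<in> ?C)" using z' unfolding R C by auto
          then have "x \<in> ?X" "y \<in> ?Y" using st unfolding new_iff by blast+
          then show "c \<in> stairs D ?Z ?X ?Y" using xy st by (simp add: stairs_def bip_diagram_def)
        qed
        moreover have "stairs D ?Z ?X ?Y \<subseteq> stairs D ?Z X Y - ?new"
          unfolding stairs_def bip_diagram_def new_excess_def by blast
        ultimately have "stairs D ?Z X Y - snd (rect_decomp D X Y) = stairs D (?X \<union> ?Y) ?X ?Y - snd (rect_decomp D ?X ?Y)"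
          unfolding excess Z by blast
        moreover have "card ?X + card ?Y < card X + card Y"
          using fin block_mem(1) by (intro card_Diff_less) (auto simp: R C)
        note IH = less.hyps[OF this fin' diag' V2]
        have count: "count_rect (upper_blocks D X Y) = Suc (count_rect (upper_blocks D ?X ?Y))"
          and ex: "(\<exists>b\<in>set (upper_blocks D X Y). is_empty_rect b) \<longleftrightarrow> (\<exists>b\<in>set (upper_blocks D ?X ?Y). is_empty_rect b)"
          unfolding blocks by (simp_all add: count_rect_def)
        show ?thesis
        proof (cases "\<exists>b\<in>set (upper_blocks D ?X ?Y). is_empty_rect b")
          case True
          then show ?thesis using IH block(3) unfolding ex by (simp only: if_True)
        next
          case False
          let ?k = "count_rect (upper_blocks D ?X ?Y)"
          let ?s = "card (stairs D (?X \<union> ?Y) ?X ?Y - snd (rect_decomp D ?X ?Y))"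
          have "1 \<le> ?k" "0 < ?s" "folds_to_cross ?E (?X \<inter> ?Y) (?k - 1) ?s"
            using IH False by (simp_all only: if_False)
          moreover from this have "folds_to_cross ?E ?V (Suc ?k - 1) ?s"
            using block(2)[of "?k - 1" ?s] by simp
          ultimately show ?thesis using False \<open>stairs D ?Z X Y - _ = _\<close> unfolding ex count by simp
        qed
      qed
    next
      case False
      then have mn_cell: "(Max ?R, Min ?C) \<notin> bip_diagram D X Y" using mnR by (simp add: bip_diagram_def)
      note step = rect_decomp_pedestal[OF fin top mn_cell]
      \<comment> \<open>Otherwise the position \<open>(m, n)\<close> would be above the diagonal, hence a cell.\<close>
      have nm: "n \<le> m" using False cell[of m n] mn(1,2) by force
      let ?I = "{z \<in> ?V. n \<le> z \<and> z \<le> m}"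
      let ?W = "insert (Min X) (insert (Max Y) ?I)"
      have Vfin: "finite ?V" using fin by simp
      have "\<not> below_diagonal (Pedestal ?R ?C)"
        unfolding below_diagonal_def using block_mem le by (auto simp: not_less)
      then have blocks: "upper_blocks D X Y = [Pedestal ?R ?C]"
        unfolding upper_blocks_def step by simp
      let ?T = "{(x, y). x \<in> ?V \<and> y \<in> ?V \<and> x \<le> m \<and> n \<le> y \<and> x < y \<and> {x<..<y} \<inter> ?Z = {}}"
      have "stairs D ?Z X Y - ?new = ?T"
      proof (intro equalityI subsetI)
        fix c assume c: "c \<in> stairs D ?Z X Y - ?new"
        obtain x y where xy: "c = (x, y)" by fastforce
        then have st: "(x, y) \<in> D" "x \<in> X" "y \<in> Y" "x < y" "{x<..<y} \<inter> ?Z = {}" "(x, y) \<notin> ?new"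
          using c by (auto simp: stairs_def bip_diagram_def)
        have "x \<in> ?R" "y \<in> ?C"
          using st nm unfolding new_excess_def bip_diagram_def R C by auto
        then show "c \<in> ?T" using xy st RV CV unfolding R C by auto
      next
        fix c assume c: "c \<in> ?T"
        obtain x y where xy: "c = (x, y)" by fastforce
        then have st: "x \<in> X" "y \<in> Y" "x \<le> m" "n \<le> y" "x < y" "{x<..<y} \<inter> ?Z = {}"
          using c by auto
        have "(x, y) \<in> D" using st by (intro cell)
        moreover have "(x, y) \<notin> ?new"
          unfolding new_excess_def bip_diagram_def R C using st by auto
        ultimately show "c \<in> stairs D ?Z X Y - ?new"
          using xy st by (simp add: stairs_def bip_diagram_def)
      qed
      moreover have "card ?T = Suc (card ?I)"
        by (rule pedestal_staircase_card[of ?V "Min X" n m "Max Y" ?Z])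
          (use Vfin minV maxV nV lt nm range min max in auto)
      ultimately have card: "card (stairs D ?Z X Y - snd (rect_decomp D X Y)) = Suc (card ?I)"
        unfolding step by simp
      let ?S1 = "{z \<in> ?V. z < n \<and> z \<noteq> Min X}" and ?S2 = "{z \<in> ?V. m < z \<and> z \<noteq> Max Y}"
      \<comment> \<open>The first vertex lets all others before \<open>n\<close> be deleted, and the last vertex all others after \<open>m\<close>.\<close>
      have f1: "folds_to ?E ?V (?V - ?S1)"
      proof (rule folds_to_remove_dominated[of _ _ "Min X"])
        fix z w assume z: "z \<in> ?S1" and w: "w \<in> ?V" "{Min X, w} \<in> ?E"
        then have "(z, w) \<in> D" using Nmin[OF w] nm by (intro cell) auto
        then show "{z, w} \<in> ?E" by (simp add: nonbip_edges_iff)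
      qed (use fin minV in auto)
      have f2: "folds_to ?E (?V - ?S1) (?V - ?S1 - ?S2)"
      proof (rule folds_to_remove_dominated[of _ _ "Max Y"])
        fix z w assume z: "z \<in> ?S2" and w: "w \<in> ?V - ?S1" "{Max Y, w} \<in> ?E"
        then have "(w, z) \<in> D" using Nmax[of w] nm by (intro cell) auto
        then show "{z, w} \<in> ?E" by (simp add: nonbip_edges_iff)
      qed (use fin maxV lt nm in auto)
      have eq: "?V - ?S1 - ?S2 = ?W"
        using minV maxV lt nm by auto
      have folds: "folds_to ?E ?V ?W" using folds_to_trans[OF f1 f2] unfolding eq .
      have "cross_shaped ?E ?W 0 (Suc (card ?I))"
      proof (rule clique_cross_shaped[OF E])
        show "finite ?W" using Vfin by simp
        have "Max Y \<notin> ?I" "Min X \<notin> insert (Max Y) ?I" using lt nm by auto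
        then show "card ?W = Suc (Suc (card ?I))" using Vfin by simp
        have lt_edge: "{p, q} \<in> ?E" if "p \<in> ?W" "q \<in> ?W" "p < q" for p q
        proof -
          have "q \<le> Max Y" using that(2) le max by auto
          then have "p \<le> m" using that(1,3) lt nm by auto
          have "Min X \<le> p" using that(1) le min by auto
          then have "n \<le> q" using that(2,3) lt nm by auto
          have "p \<in> X" "q \<in> Y" using that(1,2) minV maxV by auto
          then have "(p, q) \<in> D" using \<open>p \<le> m\<close> \<open>n \<le> q\<close> that(3) by (intro cell)
          then show ?thesis by (simp add: nonbip_edges_iff)
        qed
        fix p q assume "p \<in> ?W" "q \<in> ?W" "p \<noteq> q"
        then consider "{p, q} \<in> ?E" | "{q, p} \<in> ?E"
          using lt_edge[of p q] lt_edge[of q p] by fastforce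
        then show "{p, q} \<in> ?E" by (simp add: insert_commute nonbip_edges_iff)
      qed
      then have "folds_to_cross ?E ?V 0 (Suc (card ?I))"
        using folds unfolding folds_to_cross_def by blast
      then show ?thesis unfolding card blocks by (simp add: count_rect_def)
    qed
  qed
qed

lemma nonbip_homotopy_type:
  assumes D: "shifted_skew_diagram D" and fin: "finite X" and ne: "X \<noteq> {}"
  shows "if \<exists>b\<in>set (nonbip_blocks D X). is_empty_rect b
       then contractible_space (realization (indep_complex (nonbip_graph D X)))
       else 1 \<le> nonbip_rect D X \<and>
         realization (indep_complex (nonbip_graph D X)) homotopy_equivalent_space
           wedge_of_spheres (card (staircase_cells D X - nonbip_excess D X)) (nonbip_rect D X - 1)"
proof -
  have E: "simple_edges (nonbip_edges D)"
    by (rule simple_nonbip_edges[OF shifted_skew_diagram_convex[OF D]])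
  have blocks: "upper_blocks D X X = nonbip_blocks D X"
    by (simp add: upper_blocks_def nonbip_blocks_def)
  have stairs: "stairs D (X \<union> X) X X = staircase_cells D X"
    by (simp add: stairs_def staircase_cells_def)
  have "diagonal_pair X X" by (simp add: diagonal_pair_def)
  note red = nonbip_reduction[OF D fin fin this, unfolded blocks stairs Int_absorb, OF ne]
  show ?thesis
  proof (cases "\<exists>b\<in>set (nonbip_blocks D X). is_empty_rect b")
    case True
    then show ?thesis
      using red folds_to_cone_realization[OF E fin] unfolding indep_complex_nonbip_graph by (simp only: if_True)
  next
    case False
    then show ?thesis
      using red folds_to_cross_realization[OF E fin]
      unfolding indep_complex_nonbip_graph nonbip_rect_def nonbip_excess_def by (simp only: if_False)
  qed
qed

section \<open>The homotopy types\<close>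

theorem theorem2p15:
  fixes D :: "(nat \<times> nat) set"
  assumes "shifted_skew_diagram D"
  shows "(\<forall>X Y. finite X \<and> finite Y \<and> X \<subseteq> {1..} \<and> Y \<subseteq> {1..} \<and> (X \<noteq> {} \<or> Y \<noteq> {}) \<longrightarrow>
      (if spherical D X Y
       then 1 \<le> bip_rect D X Y \<and>
         realization (indep_complex (bip_graph D X Y)) homotopy_equivalent_space
           nsphere (bip_rect D X Y - 1)
       else contractible_space (realization (indep_complex (bip_graph D X Y))))) \<and>
    (\<forall>X. finite X \<and> X \<subseteq> {1..} \<and> X \<noteq> {} \<longrightarrow>
      (if \<exists>b\<in>set (nonbip_blocks D X). is_empty_rect b
       then contractible_space (realization (indep_complex (nonbip_graph D X)))
       else 1 \<le> nonbip_rect D X \<and>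
         realization (indep_complex (nonbip_graph D X)) homotopy_equivalent_space
           wedge_of_spheres (card (staircase_cells D X - nonbip_excess D X)) (nonbip_rect D X - 1)))"
proof (intro conjI allI impI)
  fix X Y :: "nat set"
  assume XY: "finite X \<and> finite Y \<and> X \<subseteq> {1..} \<and> Y \<subseteq> {1..} \<and> (X \<noteq> {} \<or> Y \<noteq> {})"
  show "if spherical D X Y
       then 1 \<le> bip_rect D X Y \<and>
         realization (indep_complex (bip_graph D X Y)) homotopy_equivalent_space
           nsphere (bip_rect D X Y - 1)
       else contractible_space (realization (indep_complex (bip_graph D X Y)))"
  proof (cases "spherical D X Y")
    case True
    then show ?thesis using bip_homotopy_type(1) [OF assms, of X Y] XY by simp
  next
    case False
    then show ?thesis using bip_homotopy_type(2) [OF assms, of X Y] XY by simp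
  qed
next
  fix X :: "nat set"
  assume "finite X \<and> X \<subseteq> {1..} \<and> X \<noteq> {}"
  then have "finite X" "X \<noteq> {}" by blast+
  then show "if \<exists>b\<in>set (nonbip_blocks D X). is_empty_rect b
       then contractible_space (realization (indep_complex (nonbip_graph D X)))
       else 1 \<le> nonbip_rect D X \<and>
         realization (indep_complex (nonbip_graph D X)) homotopy_equivalent_space
           wedge_of_spheres (card (staircase_cells D X - nonbip_excess D X)) (nonbip_rect D X - 1)"
    by (rule nonbip_homotopy_type [OF assms])
qed

end
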